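(* Let $s,t$ be positive integers and $a,b$ integers with $0\le a<s$ and $0\le b<t$. Let $g=\gcd(s,t)$ and assume $g$ and $a-b$ are coprime. Then \[ \bigl|\mathcal{C}_{(s|0,a)}\cap\mathcal{C}_{(t|0,b)}\cap\mathcal{C}_g^2\bigr|=\frac1g\,\bigl|U_g^{s,a}\bigr|\,\bigl|U_g^{t,b}\bigr|. \] In particular, if $s$ divides $t$, then $\bigl|\mathcal{C}_{(s|0,a)}\cap\mathcal{C}_{(t|0,b)}\bigr|=\frac1s\binom sa\bigl|U_s^{t,b}\bigr|$.
   Context: A partition is a weakly decreasing sequence of non-negative integers with finite sum; a bipartition is a pair $(\lambda,\mu)$ of partitions, with nodes $(a,b,1)$ for $b\le\lambda_a$ and $(a,b,2)$ for $b\le\mu_a$. For $s\ge0$ and $c=(c_1,c_2)\in\mathbb{Z}^2$, the $(s\,|\,c)$-residue of a node $(a,b,k)$ is $b-a+c_k+s\mathbb{Z}$, and the $(s\,|\,c)$-content of a bipartition is the multiset of residues of its nodes. A bipartition is an $(s\,|\,c)$-core if no other bipartition has the same $(s\,|\,c)$-content (for $s=1$ the only $(1\,|\,c)$-core is $(\varnothing,\varnothing)$); $\mathcal{C}_{(s|c_1,c_2)}$ is the set of such cores. A partition is a $g$-core if none of its hook lengths equals $g$; $\mathcal{C}_g^2$ denotes the set of bipartitions both of whose components are $g$-cores. For positive integers $g\mid s$ and integer $a$, $U_g^{s,a}$ is the set of functions $u:\mathbb{Z}/g\mathbb{Z}\to\mathbb{Z}$ with $\sum_{i\in\mathbb{Z}/g\mathbb{Z}}u_i=a$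 and $0\le u_i\le s/g$ for all $i$. *)

theory Defs
  imports Complex_Main "HOL-Library.Multiset" "HOL-Library.FuncSet"
begin

text \<open>Partitions are 0-based: \<open>lam i\<close> is the part usually written \<open>\<lambda>\<^sub>i\<^sub>+\<^sub>1\<close>.
  For sequences of natural numbers, finite sum means finite support.\<close>

definition is_partition :: "(nat \<Rightarrow> nat) \<Rightarrow> bool" where
  "is_partition lam \<longleftrightarrow> antimono lam \<and> finite {i. lam i \<noteq> 0}"

type_synonym bipart = "(nat \<Rightarrow> nat) \<times> (nat \<Rightarrow> nat)"

definition is_bipartition :: "bipart \<Rightarrow> bool" where
  "is_bipartition p \<longleftrightarrow> is_partition (fst p) \<and> is_partition (snd p)"

text \<open>Rows and columns both start at 0, so the node \<open>(i, j)\<close> here is \<open>(i + 1, j + 1)\<close> in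
  1-based coordinates; the difference column minus row is the same in both.\<close>

definition diagram :: "(nat \<Rightarrow> nat) \<Rightarrow> (nat \<times> nat) set" where
  "diagram lam = {(i, j). j < lam i}"

definition nodes :: "bipart \<Rightarrow> (nat \<times> nat \<times> nat) set" where
  "nodes p = {(i, j, k). k = 1 \<and> (i, j) \<in> diagram (fst p) \<or> k = 2 \<and> (i, j) \<in> diagram (snd p)}"

text \<open>The class of \<open>x\<close> modulo \<open>s\<int>\<close> is represented by \<open>x mod s\<close>; as \<open>x mod 0 = x\<close>,
  this is also right for \<open>s = 0\<close>.\<close>

definition residue :: "nat \<Rightarrow> int \<times> int \<Rightarrow> nat \<times> nat \<times> nat \<Rightarrow> int" where
  "residue s c = (\<lambda>(i, j, k). (int j - int i + (if k = 1 then fst c else snd c)) mod int s)"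

definition content :: "nat \<Rightarrow> int \<times> int \<Rightarrow> bipart \<Rightarrow> int multiset" where
  "content s c p = image_mset (residue s c) (mset_set (nodes p))"

definition bicores :: "nat \<Rightarrow> int \<times> int \<Rightarrow> bipart set" where
  "bicores s c = {p. is_bipartition p \<and>
     (\<forall>q. is_bipartition q \<and> content s c q = content s c p \<longrightarrow> q = p)}"

definition hook_length :: "(nat \<Rightarrow> nat) \<Rightarrow> nat \<times> nat \<Rightarrow> nat" where
  "hook_length lam = (\<lambda>(i, j).
     card {(i', j') \<in> diagram lam. i' = i \<and> j \<le> j' \<or> j' = j \<and> i \<le> i'})"

definition g_cores :: "nat \<Rightarrow> (nat \<Rightarrow> nat) set" where
  "g_cores g = {lam. is_partition lam \<and> (\<forall>n \<in> diagram lam. hook_length lam n \<noteq> g)}"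

text \<open>\<open>\<int>/g\<int>\<close> is represented by \<open>{0..<g}\<close>, and functions on it are taken extensional
  so that each is counted once. The definition is meant for positive \<open>g\<close> dividing \<open>s\<close>.\<close>

definition U_funs :: "nat \<Rightarrow> nat \<Rightarrow> int \<Rightarrow> (int \<Rightarrow> int) set" where
  "U_funs g s a = {u \<in> {0..<int g} \<rightarrow>\<^sub>E UNIV.
     (\<Sum>i\<in>{0..<int g}. u i) = a \<and> (\<forall>i\<in>{0..<int g}. 0 \<le> u i \<and> u i \<le> int (s div g))}"

end

(* Encode a partition of charge c by its beads lam i - i - 1 + c, a set of integers. With X and Y
   the bead sets of charges 0 and a of the two components, a bipartition is an (s|0,a)-core iff
   X <= Y <= X + s (as sets): otherwise exchanging a bead of X - Y with one of Y - X (or doing so for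
   the pair Y, X + s) gives another bipartition of the same content, and conversely such pairs
   are the unique ones of minimal size among bipartitions with the same number of beads in each class
   modulo s. A pair of g-cores is given by the first gaps F, G in each class modulo g, at charge 0, and
   the two core conditions say that the differences of F and the shifts of G by a and by b, divided
   by g, lie in U_g^{s,a} and U_g^{t,b}. As a - b is a unit modulo g, such a pair of differences
   determines (F, G) up to adding a common multiple of g; restricting to charge 0 selects one in
   g of the possibilities. *)

theory Submission
  imports Defs "HOL-Library.Infinite_Set"
begin

section \<open>Bead sets of partitions\<close>

text \<open>Contents and beads are linked by one fact: adding a node of content k moves a bead from
  k - 1 to k, so the sum of f over the beads grows by f k - f (k - 1). If these increments depend
  only on k mod s, the residue content fixes the bead sum of f. Two kinds of f suffice to show that
  a pair X <= Y <= X + s is alone with its content: b - F b, with F b the first gap of X in the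
  class of b modulo s, and the indicators of classes. Arbitrary f show that exchanging beads between
  the components changes no content.

  The factor 1/g is a matter of charge. The differences of (F, G) see it only modulo g, since adding
  g * k to both functions changes it by g * k. Translating both bead sets by 1 respects the core
  conditions, raises the charge by 1 and merely rotates the differences, so all charges contribute
  equally.\<close>

definition bead :: "int \<Rightarrow> (nat \<Rightarrow> nat) \<Rightarrow> nat \<Rightarrow> int" where
  "bead c lam i = int (lam i) - int i - 1 + c"

definition beta :: "int \<Rightarrow> (nat \<Rightarrow> nat) \<Rightarrow> int set" where
  "beta c lam = range (bead c lam)"

text \<open>The set \<open>{..<c}\<close> has charge \<open>c\<close>, and moving finitely many
  beads keeps the charge. The upper bound \<open>M\<close> makes the counted set finite;
  \<open>card\<close> would be 0 on an infinite one.\<close>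

definition maya :: "int \<Rightarrow> int set \<Rightarrow> bool" where
  "maya c B \<longleftrightarrow> (\<exists>L M. {..<L} \<subseteq> B \<and> B \<subseteq> {..<M} \<and> int (card (B \<inter> {L..})) = c - L)"

text \<open>Lowering the cutoff by one adds one bead and raises \<open>c - L\<close> by one. Hence
  any two bead sets can be compared at a common cutoff.\<close>

lemma maya_below:
  assumes "maya c B"
  obtains L0 M where "B \<subseteq> {..<M}"
    "\<And>L. L \<le> L0 \<Longrightarrow> {..<L} \<subseteq> B \<and> finite (B \<inter> {L..}) \<and> int (card (B \<inter> {L..})) = c - L"
proof -
  obtain L0 M where L0: "{..<L0} \<subseteq> B" and M: "B \<subseteq> {..<M}"
    and card: "int (card (B \<inter> {L0..})) = c - L0"
    using assms unfolding maya_def by blast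
  have "{..<L} \<subseteq> B \<and> finite (B \<inter> {L..}) \<and> int (card (B \<inter> {L..})) = c - L" if "L \<le> L0" for L
  proof -
    have fin: "finite (B \<inter> {l..})" for l
      by (rule finite_subset[of _ "{l..<M}"]) (use M in auto)
    have "B \<inter> {L..} = {L..<L0} \<union> (B \<inter> {L0..})" using L0 that by auto
    then have "card (B \<inter> {L..}) = card {L..<L0} + card (B \<inter> {L0..})"
      using fin by (simp only:) (rule card_Un_disjoint, auto)
    then show ?thesis using L0 that card fin by auto
  qed
  then show thesis using M that by blast
qed

text \<open>Above a common cutoff, \<open>Y\<close> is a subset of a finite part of \<open>X\<close>
  with at least as many elements.\<close>

lemma maya_antimono_eq:
  assumes X: "maya c X" and Y: "maya d Y" and "c \<le> d" and "Y \<subseteq> X"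
  shows "X = Y"
proof -
  obtain L1 M1 where "X \<subseteq> {..<M1}"
    and L1: "\<And>L. L \<le> L1 \<Longrightarrow> {..<L} \<subseteq> X \<and> finite (X \<inter> {L..}) \<and> int (card (X \<inter> {L..})) = c - L"
    by (rule maya_below[OF X]) (rule that)
  obtain L2 M2 where "Y \<subseteq> {..<M2}"
    and L2: "\<And>L. L \<le> L2 \<Longrightarrow> {..<L} \<subseteq> Y \<and> finite (Y \<inter> {L..}) \<and> int (card (Y \<inter> {L..})) = d - L"
    by (rule maya_below[OF Y]) (rule that)
  define L where "L = min L1 L2"
  have 1: "{..<L} \<subseteq> X" "finite (X \<inter> {L..})" "int (card (X \<inter> {L..})) = c - L"
    using L1[of L] by (auto simp: L_def)
  have 2: "{..<L} \<subseteq> Y" "int (card (Y \<inter> {L..})) = d - L" using L2[of L] by (auto simp: L_def)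
  have "Y \<inter> {L..} = X \<inter> {L..}"
  proof (rule card_seteq)
    show "card (X \<inter> {L..}) \<le> card (Y \<inter> {L..})" using 1 2 \<open>c \<le> d\<close> by linarith
  qed (use 1 \<open>Y \<subseteq> X\<close> in auto)
  then have "x \<in> X \<longleftrightarrow> x \<in> Y" for x using 1(1) 2(1) by (cases "x < L") auto
  then show ?thesis by blast
qed

lemma maya_swap:
  assumes X: "maya c X" and "x \<in> X" and "y \<notin> X"
  shows "maya c (insert y (X - {x}))"
proof -
  obtain L1 M where M: "X \<subseteq> {..<M}" and
    L1: "\<And>L. L \<le> L1 \<Longrightarrow> {..<L} \<subseteq> X \<and> finite (X \<inter> {L..}) \<and> int (card (X \<inter> {L..})) = c - L"
    by (rule maya_below[OF X]) (rule that)
  define L where "L = min L1 (min x y)"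
  have L: "{..<L} \<subseteq> X" "finite (X \<inter> {L..})" "int (card (X \<inter> {L..})) = c - L"
    using L1[of L] by (auto simp: L_def)
  have le: "L \<le> x" "L \<le> y" by (auto simp: L_def)
  have "insert y (X - {x}) \<inter> {L..} = insert y ((X \<inter> {L..}) - {x})" using le by auto
  then have "card (insert y (X - {x}) \<inter> {L..}) = Suc (card ((X \<inter> {L..}) - {x}))"
    using assms(3) L(2) by simp
  also have "\<dots> = card (X \<inter> {L..})"
    using assms(2) L(2) le by (subst card.remove[of _ x]) auto
  finally have "int (card (insert y (X - {x}) \<inter> {L..})) = c - L" using L by simp
  moreover have "{..<L} \<subseteq> insert y (X - {x})" using L le by auto
  moreover have "insert y (X - {x}) \<subseteq> {..<max M (y + 1)}" using M by auto
  ultimately show ?thesis unfolding maya_def by blast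
qed

section \<open>Partitions correspond to bead sets of a given charge\<close>

lemma bead_strict:
  assumes "is_partition lam" and "i < j"
  shows "bead c lam j < bead c lam i"
  using assms antimonoD[of lam i j] by (auto simp: is_partition_def bead_def)

lemma bead_less_iff: "is_partition lam \<Longrightarrow> bead c lam j < bead c lam i \<longleftrightarrow> i < j"
  using bead_strict by (metis linorder_neqE_nat order_less_asym)

lemma inj_bead: "is_partition lam \<Longrightarrow> inj (bead c lam)"
  using bead_strict by (intro linorder_injI) (metis order_less_irrefl)

lemma is_partition_eventually_0:
  assumes "is_partition lam"
  obtains N where "\<And>i. N \<le> i \<Longrightarrow> lam i = 0"
proof -
  have "finite {i. lam i \<noteq> 0}" using assms by (simp add: is_partition_def)
  then obtain N where "{i. lam i \<noteq> 0} \<subseteq> {..<N}" using finite_nat_bounded by blast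
  then show thesis using that[of N] by fastforce
qed

text \<open>The empty rows \<open>i \<ge> N\<close> give the beads \<open>c - 1 - i\<close>, which
  fill everything below \<open>c - N\<close>.\<close>

lemma beta_truncate:
  assumes lam: "is_partition lam" and N: "\<And>i. N \<le> i \<Longrightarrow> lam i = 0"
  shows "{..<c - int N} \<subseteq> beta c lam" "beta c lam \<inter> {c - int N..} = bead c lam ` {..<N}"
proof -
  show "{..<c - int N} \<subseteq> beta c lam"
  proof
    fix x assume "x \<in> {..<c - int N}"
    then have "x = bead c lam (nat (c - 1 - x))" by (subst bead_def, subst N) auto
    then show "x \<in> beta c lam" unfolding beta_def by blast
  qed
  have "c - int N \<le> bead c lam i \<longleftrightarrow> i < N" for i
    using N[of i] by (cases "i < N") (auto simp: bead_def)
  then show "beta c lam \<inter> {c - int N..} = bead c lam ` {..<N}" by (auto simp: beta_def)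
qed

lemma maya_beta:
  assumes "is_partition lam" shows "maya c (beta c lam)"
proof -
  obtain N where N: "\<And>i. N \<le> i \<Longrightarrow> lam i = 0" using is_partition_eventually_0[OF assms] by blast
  have "bead c lam i < bead c lam 0 + 1" for i
    using bead_strict[OF assms, of 0 i c] by (cases i) auto
  then have "beta c lam \<subseteq> {..<bead c lam 0 + 1}" by (auto simp: beta_def)
  moreover have "card (bead c lam ` {..<N}) = N"
    using inj_on_subset[OF inj_bead[OF assms] subset_UNIV] by (simp add: card_image)
  ultimately show ?thesis using beta_truncate[where c=c, of lam N, OF assms] N unfolding maya_def
    by (intro exI[of _ "c - int N"] exI[of _ "bead c lam 0 + 1"]) simp
qed

text \<open>The index of a bead is recovered from the set alone, as the number of larger beads. This
  gives uniqueness of the partition and also fixes the beads far down.\<close>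

lemma card_greater_antimono:
  fixes b :: "nat \<Rightarrow> int"
  assumes "\<And>i j. i < j \<Longrightarrow> b j < b i"
  shows "card {x \<in> range b. b i < x} = i"
proof -
  have "b i < b j \<longleftrightarrow> j < i" for j using assms by (metis linorder_neqE_nat order_less_asym)
  then have "{x \<in> range b. b i < x} = b ` {..<i}" by auto
  moreover have "inj b" using assms by (intro linorder_injI) (metis order_less_irrefl)
  ultimately show ?thesis by (simp add: card_image inj_on_subset)
qed

lemma beta_inject:
  assumes "is_partition lam" "is_partition mu" and eq: "beta c lam = beta c mu"
  shows "lam = mu"
proof
  fix i
  obtain j where j: "bead c lam i = bead c mu j" using eq unfolding beta_def by (metis rangeE rangeI)
  have "i = j"
    using card_greater_antimono[of "bead c lam" i] card_greater_antimono[of "bead c mu" j] bead_strict assms j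
    by (simp add: beta_def)
  then show "lam i = mu i" using j by (simp add: bead_def)
qed

lemma beta_shift: "beta (c + d) lam = (+) d ` beta c lam"
  by (auto simp: beta_def bead_def image_image)

text \<open>The reflection \<open>x \<mapsto> M - x\<close> turns the bead set into an infinite set
  of naturals, which \<open>enumerate\<close> lists in increasing order.\<close>

lemma maya_enumerate:
  assumes "maya c B"
  obtains b :: "nat \<Rightarrow> int" where "\<And>i j. i < j \<Longrightarrow> b j < b i" "range b = B"
proof -
  obtain L M where L: "{..<L} \<subseteq> B" and M: "B \<subseteq> {..<M}" using assms unfolding maya_def by blast
  define S where "S = {n. M - int n \<in> B}"
  have "inf": "infinite S"
  proof -
    \<comment> \<open>Once \<open>n > M - L\<close>, the position \<open>M - n\<close> lies below
      \<open>L\<close> and is a bead.\<close>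
    have "\<exists>n>m. n \<in> S" for m
      by (intro exI[of _ "max (Suc m) (nat (M - L + 1))"]) (use L in \<open>auto simp: S_def\<close>)
    then show ?thesis by (simp add: infinite_nat_iff_unbounded)
  qed
  have r: "range (enumerate S) = S" using "inf" by (simp add: range_enumerate)
  have im: "(\<lambda>n. M - int n) ` S = B"
  proof (intro equalityI subsetI)
    fix x assume "x \<in> B"
    then show "x \<in> (\<lambda>n. M - int n) ` S"
      using M by (intro image_eqI[of _ _ "nat (M - x)"]) (auto simp: S_def)
  qed (auto simp: S_def)
  show thesis
  proof (rule that[of "\<lambda>i. M - int (enumerate S i)"])
    show "M - int (enumerate S j) < M - int (enumerate S i)" if "i < j" for i j
      using enumerate_mono[OF that "inf"] by simp
    show "range (\<lambda>i. M - int (enumerate S i)) = B" using r im by (metis image_image)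
  qed
qed

text \<open>The part \<open>lam i\<close> is the distance of the \<open>i\<close>-th largest bead
  from \<open>c - 1 - i\<close>, its position in the empty partition; the charge makes this distance
  0 for large \<open>i\<close>.\<close>

lemma maya_obtain_partition:
  assumes B: "maya c B"
  obtains lam where "is_partition lam" "beta c lam = B"
proof -
  obtain b :: "nat \<Rightarrow> int" where mono: "\<And>i j. i < j \<Longrightarrow> b j < b i" and range: "range b = B"
    using maya_enumerate[OF B] by blast
  obtain L M where L: "{..<L} \<subseteq> B" and M: "B \<subseteq> {..<M}" and card: "int (card (B \<inter> {L..})) = c - L"
    using B unfolding maya_def by blast
  have fin: "finite (B \<inter> {l..})" for l
    by (rule finite_subset[of _ "{l..<M}"]) (use M in auto)
  have ci: "card {x \<in> B. b i < x} = i" for i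
    using card_greater_antimono[of b i] mono range by simp
  define N where "N = card (B \<inter> {L..})"
  \<comment> \<open>Counting the \<open>i\<close> beads above \<open>b i\<close> on both sides of
    \<open>L\<close> gives \<open>i = (L - 1 - b i) + (c - L)\<close>.\<close>
  have tail: "b i = c - 1 - int i" if "N \<le> i" for i
  proof -
    have lt: "b i < L"
    proof (rule ccontr)
      assume "\<not> b i < L"
      then have "b i \<in> B \<inter> {L..}" "{x \<in> B. b i < x} \<subseteq> B \<inter> {L..}" using range by auto
      then have "{x \<in> B. b i < x} \<subset> B \<inter> {L..}" by blast
      from psubset_card_mono[OF fin this] have "i < N" using ci[of i] by (simp add: N_def)
      then show False using that by simp
    qed
    have "{x \<in> B. b i < x} = {b i<..<L} \<union> (B \<inter> {L..})" using lt L by auto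
    then have "i = card ({b i<..<L} \<union> (B \<inter> {L..}))" using ci[of i] by simp
    also have "\<dots> = card {b i<..<L} + card (B \<inter> {L..})" using fin by (intro card_Un_disjoint) auto
    finally show ?thesis using card lt by simp
  qed
  have anti: "b j + int j \<le> b i + int i" if "i \<le> j" for i j
    using that
  proof (induction rule: dec_induct)
    case (step n) then show ?case using mono[of n "Suc n"] by simp
  qed simp
  define lam where "lam i = nat (b i + int i + 1 - c)" for i
  \<comment> \<open>The values \<open>b i + i\<close> decrease weakly to their final value
    \<open>c - 1\<close>.\<close>
  have ge: "0 \<le> b i + int i + 1 - c" for i
    using anti[of i "max i N"] tail[of "max i N"] by simp
  have "antimono lam" using anti by (auto simp: lam_def antimono_def intro!: nat_mono)
  moreover have "{i. lam i \<noteq> 0} \<subseteq> {..<N}" using tail by (force simp: lam_def not_le[symmetric])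
  ultimately have "is_partition lam" by (auto simp: is_partition_def intro: finite_subset)
  moreover have "bead c lam = b" using ge by (auto simp: bead_def lam_def)
  ultimately show thesis using that range by (simp add: beta_def)
qed

section \<open>Hooks and contents in terms of beads\<close>

text \<open>Here \<open>k\<close> is the length of column \<open>j\<close>. The arm together with
  the corner has \<open>lam i - j\<close> nodes, the leg has \<open>k - i - 1\<close>.\<close>

lemma hook_length_eq:
  assumes "\<And>i'. j < lam i' \<longleftrightarrow> i' < k" and "j < lam i"
  shows "int (hook_length lam (i, j)) = int (lam i) - int i - 1 - (int j - int k)"
proof -
  have "i < k" using assms by blast
  have eq: "{(i', j') \<in> diagram lam. i' = i \<and> j \<le> j' \<or> j' = j \<and> i \<le> i'}
      = {i} \<times> {j..<lam i} \<union> {i<..<k} \<times> {j}"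
  proof (rule set_eqI)
    fix x :: "nat \<times> nat"
    obtain i' j' where x: "x = (i', j')" by (cases x)
    show "x \<in> {(i', j') \<in> diagram lam. i' = i \<and> j \<le> j' \<or> j' = j \<and> i \<le> i'} \<longleftrightarrow>
        x \<in> {i} \<times> {j..<lam i} \<union> {i<..<k} \<times> {j}"
      using assms(1)[of i'] assms(2)
      by (cases "i' = i"; cases "j' = j") (auto simp: x diagram_def)
  qed
  have "hook_length lam (i, j) = card ({i} \<times> {j..<lam i} \<union> {i<..<k} \<times> {j})"
    unfolding hook_length_def prod.case eq ..
  also have "\<dots> = card ({i} \<times> {j..<lam i}) + card ({i<..<k} \<times> {j})"
    by (rule card_Un_disjoint) auto
  also have "\<dots> = (lam i - j) + (k - Suc i)" by simp
  finally show ?thesis using \<open>i < k\<close> assms(2) by simp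
qed

lemma partition_column:
  assumes "is_partition lam"
  obtains k where "\<And>i. j < lam i \<longleftrightarrow> i < k"
proof -
  obtain N where N: "\<And>i. N \<le> i \<Longrightarrow> lam i = 0" using is_partition_eventually_0[OF assms] by blast
  define k where "k = (LEAST i. lam i \<le> j)"
  have "lam N \<le> j" using N[of N] by simp
  then have k: "lam k \<le> j" unfolding k_def by (rule LeastI)
  have "j < lam i \<longleftrightarrow> i < k" for i
  proof
    assume "j < lam i"
    then show "i < k" using k antimonoD[of lam k i] assms by (force simp: is_partition_def)
  next
    assume "i < k"
    then show "j < lam i" unfolding k_def using not_less_Least by force
  qed
  then show thesis using that by blast
qed

text \<open>The hook of a node pairs a bead with a gap below it, and the hook length is their distance;
  the gap belonging to column \<open>j\<close> of length \<open>k\<close> is \<open>j - k\<close> (for charge 0).\<close>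

lemma g_cores_iff_beta:
  assumes lam: "is_partition lam" and "0 < g"
  shows "lam \<in> g_cores g \<longleftrightarrow> (\<forall>x\<in>beta 0 lam. x - int g \<in> beta 0 lam)"
proof -
  have anti: "i \<le> j \<Longrightarrow> lam j \<le> lam i" for i j using lam by (simp add: is_partition_def antimonoD)
  have "(\<exists>n\<in>diagram lam. hook_length lam n = g) \<longleftrightarrow> (\<exists>x\<in>beta 0 lam. x - int g \<notin> beta 0 lam)"
  proof
    assume "\<exists>n\<in>diagram lam. hook_length lam n = g"
    then obtain i j where ij: "j < lam i" and h: "hook_length lam (i, j) = g"
      by (auto simp: diagram_def)
    obtain k where k: "\<And>i. j < lam i \<longleftrightarrow> i < k" using partition_column[OF lam] by blast
    have eq: "bead 0 lam i - int g = int j - int k"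
      using hook_length_eq[of j lam k i] k ij h by (simp add: bead_def)
    \<comment> \<open>Rows before \<open>k\<close> exceed \<open>j\<close> and have beads beyond
      \<open>j - k\<close>; the remaining rows have beads before it.\<close>
    have "bead 0 lam i' \<noteq> int j - int k" for i'
      using k[of i'] by (cases "i' < k") (auto simp: bead_def)
    then have "int j - int k \<notin> beta 0 lam" by (metis beta_def rangeE)
    with eq show "\<exists>x\<in>beta 0 lam. x - int g \<notin> beta 0 lam"
      by (intro bexI[of _ "bead 0 lam i"]) (auto simp: beta_def)
  next
    assume "\<exists>x\<in>beta 0 lam. x - int g \<notin> beta 0 lam"
    then obtain i where gap: "bead 0 lam i - int g \<notin> beta 0 lam" by (auto simp: beta_def)
    define y where "y = bead 0 lam i - int g"
    obtain N where N: "\<And>i. N \<le> i \<Longrightarrow> lam i = 0" using is_partition_eventually_0[OF lam] by blast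
    \<comment> \<open>As \<open>y\<close> is a gap, \<open>k\<close> is the number of beads above
      it. A gap \<open>j - k\<close> belongs to column \<open>j\<close>, whence
      \<open>j = y + k\<close> below.\<close>
    define k where "k = (LEAST m. bead 0 lam m < y)"
    have "bead 0 lam (max N (nat (- y))) < y" using N[of "max N (nat (- y))"] by (auto simp: bead_def)
    then have k: "bead 0 lam k < y" unfolding k_def by (rule LeastI)
    have below: "y < bead 0 lam m" if "m < k" for m
    proof -
      have "\<not> bead 0 lam m < y" using that not_less_Least unfolding k_def by blast
      moreover have "bead 0 lam m \<noteq> y" using gap by (metis y_def beta_def rangeI)
      ultimately show ?thesis by simp
    qed
    have "i < k" using k \<open>0 < g\<close> bead_less_iff[OF lam, of 0 k i] by (simp add: y_def)
    define j where "j = nat (y + int k)"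
    have j: "int j = y + int k" using k by (auto simp: j_def bead_def)
    have "int (lam k) \<le> int j" using k j by (simp add: bead_def)
    have "int j < int (lam (k - 1))" using below[of "k - 1"] \<open>i < k\<close> j by (auto simp: bead_def)
    have col: "j < lam i' \<longleftrightarrow> i' < k" for i'
    proof (cases "i' < k")
      case True
      then have "lam (k - 1) \<le> lam i'" by (intro anti) simp
      then show ?thesis using True \<open>int j < int (lam (k - 1))\<close> by linarith
    next
      case False
      then show ?thesis using anti[of k i'] \<open>int (lam k) \<le> int j\<close> by simp
    qed
    then have "int (hook_length lam (i, j)) = int g"
      using hook_length_eq[of j lam k i] \<open>i < k\<close> j by (simp add: y_def bead_def)
    then show "\<exists>n\<in>diagram lam. hook_length lam n = g"
      using col[of i] \<open>i < k\<close> by (intro bexI[of _ "(i, j)"]) (auto simp: diagram_def)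
  qed
  then show ?thesis using lam by (auto simp: g_cores_def)
qed

section \<open>Contents as telescoping sums over beads\<close>

lemma finite_diagram:
  assumes "is_partition lam" shows "finite (diagram lam)"
proof -
  obtain N where N: "\<And>i. N \<le> i \<Longrightarrow> lam i = 0" using is_partition_eventually_0[OF assms] by blast
  have "diagram lam = (SIGMA i:{..<N}. {..<lam i})"
    using N by (force simp: diagram_def not_le[symmetric])
  then show ?thesis by simp
qed

text \<open>Row \<open>i\<close> moves the bead at \<open>c - 1 - i\<close> of the empty partition up by \<open>lam i\<close>, so each node
  contributes one step of a telescoping sum.\<close>

lemma beta_sum:
  assumes lam: "is_partition lam"
  obtains L0 where "\<And>L f. L \<le> L0 \<Longrightarrow> (\<Sum>b\<in>beta c lam \<inter> {L..}. f b) =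
     (\<Sum>b\<in>{L..<c}. f b) +
     (\<Sum>(i, j)\<in>diagram lam. f (int j - int i + c) - f (int j - int i + c - 1) :: int)"
proof -
  obtain N0 where N0: "\<And>i. N0 \<le> i \<Longrightarrow> lam i = 0" using is_partition_eventually_0[OF lam] by blast
  show thesis
  proof (rule that[of "c - int N0"])
    fix L :: int and f :: "int \<Rightarrow> int"
    assume "L \<le> c - int N0"
    define N where "N = nat (c - L)"
    have NL: "L = c - int N" and "N0 \<le> N" using \<open>L \<le> c - int N0\<close> by (auto simp: N_def)
    then have N: "\<And>i. N \<le> i \<Longrightarrow> lam i = 0" using N0 by simp
    have tel: "(\<Sum>j<n. f (int j - int i + c) - f (int j - int i + c - 1))
        = f (int n - int i - 1 + c) - f (c - 1 - int i)" for n i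
      by (induction n) (auto simp: algebra_simps)
    have "diagram lam = (SIGMA i:{..<N}. {..<lam i})"
      using N by (force simp: diagram_def not_le[symmetric])
    then have "(\<Sum>(i, j)\<in>diagram lam. f (int j - int i + c) - f (int j - int i + c - 1))
        = (\<Sum>i<N. \<Sum>j<lam i. f (int j - int i + c) - f (int j - int i + c - 1))"
      by (simp add: sum.Sigma)
    also have "\<dots> = (\<Sum>i<N. f (bead c lam i)) - (\<Sum>i<N. f (c - 1 - int i))"
      unfolding tel by (simp add: bead_def sum_subtractf)
    also have "(\<Sum>i<N. f (bead c lam i)) = (\<Sum>b\<in>beta c lam \<inter> {L..}. f b)"
      using beta_truncate(2)[OF lam N, where c=c] inj_on_subset[OF inj_bead[OF lam, of c] subset_UNIV, of "{..<N}"]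
      by (simp add: NL sum.reindex)
    also have "(\<Sum>i<N. f (c - 1 - int i)) = (\<Sum>b\<in>{L..<c}. f b)"
      by (rule sum.reindex_bij_witness[of _ "\<lambda>b. nat (c - 1 - b)" "\<lambda>i. c - 1 - int i"]) (auto simp: NL)
    finally show "(\<Sum>b\<in>beta c lam \<inter> {L..}. f b) = (\<Sum>b\<in>{L..<c}. f b) +
        (\<Sum>(i, j)\<in>diagram lam. f (int j - int i + c) - f (int j - int i + c - 1))" by simp
  qed
qed

definition node_content :: "int \<times> int \<Rightarrow> nat \<times> nat \<times> nat \<Rightarrow> int" where
  "node_content c = (\<lambda>(i, j, k). int j - int i + (if k = 1 then fst c else snd c))"

lemma residue_conv: "residue s c n = node_content c n mod int s"
  by (cases n) (simp add: residue_def node_content_def)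

lemma nodes_conv:
  "nodes p = (\<lambda>(i, j). (i, j, 1)) ` diagram (fst p) \<union> (\<lambda>(i, j). (i, j, 2)) ` diagram (snd p)"
  by (auto simp: nodes_def image_iff)

lemma finite_nodes: "is_bipartition p \<Longrightarrow> finite (nodes p)"
  by (simp add: nodes_conv finite_diagram is_bipartition_def)

lemma sum_nodes:
  fixes h :: "int \<Rightarrow> int"
  assumes "is_bipartition p"
  shows "(\<Sum>n\<in>nodes p. h (node_content c n)) =
    (\<Sum>(i, j)\<in>diagram (fst p). h (int j - int i + fst c)) +
    (\<Sum>(i, j)\<in>diagram (snd p). h (int j - int i + snd c))"
proof -
  have "finite (diagram (fst p))" "finite (diagram (snd p))"
    using assms by (auto simp: is_bipartition_def finite_diagram)
  then have "(\<Sum>n\<in>nodes p. h (node_content c n)) =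
      (\<Sum>n\<in>(\<lambda>(i, j). (i, j, 1)) ` diagram (fst p). h (node_content c n)) +
      (\<Sum>n\<in>(\<lambda>(i, j). (i, j, 2)) ` diagram (snd p). h (node_content c n))"
    unfolding nodes_conv by (intro sum.union_disjoint) auto
  then show ?thesis
    by (simp add: sum.reindex inj_on_def case_prod_beta node_content_def prod_eq_iff)
qed

text \<open>Forgets which component a bead belongs to. This is what an exchange of beads preserves,
  and it already determines the content.\<close>

definition bead_count :: "int \<times> int \<Rightarrow> bipart \<Rightarrow> int \<Rightarrow> int" where
  "bead_count c p b = of_bool (b \<in> beta (fst c) (fst p)) + of_bool (b \<in> beta (snd c) (snd p))"

text \<open>The sums over \<open>{L..<fst c}\<close> and \<open>{L..<snd c}\<close> are those of the
  empty bipartition. The bounds do not depend on \<open>f\<close>, and the values 2 and 0 outside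
  them show that cutting the sum off loses nothing when two bipartitions are compared.\<close>

lemma bead_count_sum:
  assumes p: "is_bipartition p"
  obtains L0 M0 where
    "\<And>L M f. L \<le> L0 \<Longrightarrow> M0 \<le> M \<Longrightarrow> (\<Sum>b\<in>{L..<M}. bead_count c p b * f b) =
       (\<Sum>b\<in>{L..<fst c}. f b) + (\<Sum>b\<in>{L..<snd c}. f b) +
       (\<Sum>n\<in>nodes p. f (node_content c n) - f (node_content c n - 1) :: int)"
    "\<And>b. b < L0 \<Longrightarrow> bead_count c p b = 2" "\<And>b. M0 \<le> b \<Longrightarrow> bead_count c p b = 0"
proof -
  let ?X = "beta (fst c) (fst p)" and ?Y = "beta (snd c) (snd p)"
  have parts: "is_partition (fst p)" "is_partition (snd p)" using p by (auto simp: is_bipartition_def)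
  obtain L1 where L1: "\<And>L f. L \<le> L1 \<Longrightarrow> (\<Sum>b\<in>?X \<inter> {L..}. f b) = (\<Sum>b\<in>{L..<fst c}. f b) +
     (\<Sum>(i, j)\<in>diagram (fst p). f (int j - int i + fst c) - f (int j - int i + fst c - 1) :: int)"
    by (rule beta_sum[OF parts(1), of "fst c"]) (rule that)
  obtain L2 where L2: "\<And>L f. L \<le> L2 \<Longrightarrow> (\<Sum>b\<in>?Y \<inter> {L..}. f b) = (\<Sum>b\<in>{L..<snd c}. f b) +
     (\<Sum>(i, j)\<in>diagram (snd p). f (int j - int i + snd c) - f (int j - int i + snd c - 1) :: int)"
    by (rule beta_sum[OF parts(2), of "snd c"]) (rule that)
  obtain L3 M3 where 3: "{..<L3} \<subseteq> ?X" "?X \<subseteq> {..<M3}"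
    using maya_beta[OF parts(1), of "fst c"] unfolding maya_def by blast
  obtain L4 M4 where 4: "{..<L4} \<subseteq> ?Y" "?Y \<subseteq> {..<M4}"
    using maya_beta[OF parts(2), of "snd c"] unfolding maya_def by blast
  define L0 where "L0 = min (min L1 L2) (min L3 L4)"
  define M0 where "M0 = max M3 M4"
  show thesis
  proof (rule that[of L0 M0])
    fix L M :: int and f :: "int \<Rightarrow> int"
    assume LM: "L \<le> L0" "M0 \<le> M"
    have restrict: "(\<Sum>b\<in>{L..<M}. of_bool (b \<in> B) * f b) = (\<Sum>b\<in>B \<inter> {L..}. f b)"
      if "B \<subseteq> {..<M0}" for B
    proof -
      have "(\<Sum>b\<in>B \<inter> {L..}. f b) = (\<Sum>b\<in>B \<inter> {L..}. of_bool (b \<in> B) * f b)" by (intro sum.cong) auto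
      also have "\<dots> = (\<Sum>b\<in>{L..<M}. of_bool (b \<in> B) * f b)"
        by (rule sum.mono_neutral_left) (use that LM in auto)
      finally show ?thesis ..
    qed
    have "?X \<subseteq> {..<M0}" "?Y \<subseteq> {..<M0}" using 3 4 by (auto simp: M0_def)
    then have "(\<Sum>b\<in>{L..<M}. bead_count c p b * f b) = (\<Sum>b\<in>?X \<inter> {L..}. f b) + (\<Sum>b\<in>?Y \<inter> {L..}. f b)"
      by (simp only: bead_count_def distrib_right sum.distrib restrict)
    then show "(\<Sum>b\<in>{L..<M}. bead_count c p b * f b) =
       (\<Sum>b\<in>{L..<fst c}. f b) + (\<Sum>b\<in>{L..<snd c}. f b) +
       (\<Sum>n\<in>nodes p. f (node_content c n) - f (node_content c n - 1))"
      using sum_nodes[OF p, of "\<lambda>k. f k - f (k - 1)" c] L1[of L f] L2[of L f] LM by (simp add: L0_def)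
  next
    show "bead_count c p b = 2" if "b < L0" for b
      using that 3 4 by (auto simp: bead_count_def L0_def)
    show "bead_count c p b = 0" if "M0 \<le> b" for b
      using that 3 4 by (force simp: bead_count_def M0_def)
  qed
qed

text \<open>The contributions of the empty bipartition cancel, so one finite window serves every
  \<open>f\<close>.\<close>

lemma bead_count_diff_sum:
  assumes p: "is_bipartition p" and q: "is_bipartition q"
  obtains L M where "\<And>b. b \<notin> {L..<M} \<Longrightarrow> bead_count c p b = bead_count c q b"
    "\<And>f. (\<Sum>b\<in>{L..<M}. (bead_count c p b - bead_count c q b) * f b) =
       (\<Sum>n\<in>nodes p. f (node_content c n) - f (node_content c n - 1)) -
       (\<Sum>n\<in>nodes q. f (node_content c n) - f (node_content c n - 1) :: int)"
proof -
  obtain L1 M1 where 1: "\<And>L M f. L \<le> L1 \<Longrightarrow> M1 \<le> M \<Longrightarrow> (\<Sum>b\<in>{L..<M}. bead_count c p b * f b) =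
       (\<Sum>b\<in>{L..<fst c}. f b) + (\<Sum>b\<in>{L..<snd c}. f b) +
       (\<Sum>n\<in>nodes p. f (node_content c n) - f (node_content c n - 1) :: int)"
    "\<And>b. b < L1 \<Longrightarrow> bead_count c p b = 2" "\<And>b. M1 \<le> b \<Longrightarrow> bead_count c p b = 0"
    by (rule bead_count_sum[OF p, of c]) (rule that)
  obtain L2 M2 where 2: "\<And>L M f. L \<le> L2 \<Longrightarrow> M2 \<le> M \<Longrightarrow> (\<Sum>b\<in>{L..<M}. bead_count c q b * f b) =
       (\<Sum>b\<in>{L..<fst c}. f b) + (\<Sum>b\<in>{L..<snd c}. f b) +
       (\<Sum>n\<in>nodes q. f (node_content c n) - f (node_content c n - 1) :: int)"
    "\<And>b. b < L2 \<Longrightarrow> bead_count c q b = 2" "\<And>b. M2 \<le> b \<Longrightarrow> bead_count c q b = 0"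
    by (rule bead_count_sum[OF q, of c]) (rule that)
  show thesis
  proof (rule that[of "min L1 L2" "max M1 M2"])
    show "bead_count c p b = bead_count c q b" if "b \<notin> {min L1 L2..<max M1 M2}" for b
      using that 1(2,3)[of b] 2(2,3)[of b] by auto
  qed (simp add: left_diff_distrib sum_subtractf 1(1) 2(1))
qed

text \<open>Meant for \<open>h\<close> giving the increments of a test function \<open>f\<close>
  when these depend only on the class modulo \<open>s\<close>.\<close>

lemma content_eq_imp_sum_eq:
  fixes h :: "int \<Rightarrow> int"
  assumes "content s c p = content s c q" and "is_bipartition p" "is_bipartition q"
  shows "(\<Sum>n\<in>nodes p. h (node_content c n mod int s)) = (\<Sum>n\<in>nodes q. h (node_content c n mod int s))"
proof -
  have "(\<Sum>n\<in>nodes r. h (node_content c n mod int s)) = sum_mset (image_mset h (content s c r))" for r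
    by (simp add: content_def residue_conv[symmetric] multiset.map_comp comp_def sum_unfold_sum_mset)
  then show ?thesis using assms(1) by simp
qed

text \<open>The number of nodes of content \<open>k\<close> is read off with \<open>f\<close> the indicator function of \<open>{k..}\<close>.\<close>

lemma bead_count_eq_imp_content_eq:
  assumes p: "is_bipartition p" and q: "is_bipartition q"
    and eq: "bead_count c p = bead_count c q"
  shows "content s c p = content s c q"
proof -
  have cnt: "count (image_mset (node_content c) (mset_set (nodes r))) k
      = card {n \<in> nodes r. node_content c n = k}" if "is_bipartition r" for r k
    using finite_nodes[OF that] by (simp add: count_image_mset' eq_commute[of k])
  have ind: "int (card {n \<in> nodes r. node_content c n = k}) =
     (\<Sum>n\<in>nodes r. of_bool (k \<le> node_content c n) - of_bool (k \<le> node_content c n - 1))"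
    if "is_bipartition r" for r k
  proof -
    have "int (card {n \<in> nodes r. node_content c n = k}) = (\<Sum>n\<in>nodes r. of_bool (node_content c n = k))"
      using finite_nodes[OF that] by (simp add: Int_def)
    also have "\<dots> = (\<Sum>n\<in>nodes r. of_bool (k \<le> node_content c n) - of_bool (k \<le> node_content c n - 1))"
      by (intro sum.cong) auto
    finally show ?thesis .
  qed
  obtain L M where "\<And>f. (\<Sum>b\<in>{L..<M}. (bead_count c p b - bead_count c q b) * f b) =
       (\<Sum>n\<in>nodes p. f (node_content c n) - f (node_content c n - 1)) -
       (\<Sum>n\<in>nodes q. f (node_content c n) - f (node_content c n - 1) :: int)"
    by (rule bead_count_diff_sum[OF p q, of c]) (rule that)
  from this[of "\<lambda>b. of_bool (k \<le> b)" for k]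
  have "int (card {n \<in> nodes p. node_content c n = k}) = int (card {n \<in> nodes q. node_content c n = k})" for k
    using p q by (simp add: ind eq)
  then have "image_mset (node_content c) (mset_set (nodes p)) = image_mset (node_content c) (mset_set (nodes q))"
    using p q by (intro multiset_eqI) (simp add: cnt)
  then have "image_mset (\<lambda>k. k mod int s) (image_mset (node_content c) (mset_set (nodes p))) =
     image_mset (\<lambda>k. k mod int s) (image_mset (node_content c) (mset_set (nodes q)))" by simp
  then show ?thesis by (simp add: content_def residue_conv[abs_def] multiset.map_comp comp_def)
qed

section \<open>Sets of beads closed under subtracting g\<close>

text \<open>\<open>F n\<close> is the first gap in the class of \<open>n\<close> for a set closed
  under subtracting \<open>g\<close>. A periodic function on all integers, rather than one on
  classes, lets translations act without choosing representatives.\<close>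

definition tops :: "nat \<Rightarrow> (int \<Rightarrow> int) set" where
  "tops g = {F. \<forall>n. F (n mod int g) = F n \<and> F n mod int g = n mod int g}"

definition below :: "(int \<Rightarrow> int) \<Rightarrow> int set" where
  "below F = {m. m < F m}"

lemma tops_cong:
  assumes "F \<in> tops g" "m mod int g = n mod int g"
  shows "F m = F n"
proof -
  have "F (m mod int g) = F m" "F (n mod int g) = F n" using assms(1) unfolding tops_def by blast+
  then show ?thesis using assms(2) by simp
qed

lemma tops_mod: "F \<in> tops g \<Longrightarrow> F n mod int g = n mod int g"
  by (simp add: tops_def)

lemma tops_apply: "F \<in> tops g \<Longrightarrow> G \<in> tops g \<Longrightarrow> F (G n) = F n"
  by (rule tops_cong) (auto intro: tops_mod)

text \<open>\<open>G n\<close> is a gap of \<open>below G\<close>; as \<open>F (G n) = F n\<close>,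
  it would be a bead of \<open>below F\<close> if \<open>F n\<close> exceeded it.\<close>

lemma below_subset_iff:
  assumes "F \<in> tops g" "G \<in> tops g"
  shows "below F \<subseteq> below G \<longleftrightarrow> (\<forall>n. F n \<le> G n)"
proof
  assume sub: "below F \<subseteq> below G"
  show "\<forall>n. F n \<le> G n"
  proof (rule allI, rule ccontr)
    fix n assume "\<not> F n \<le> G n"
    then have "G n \<in> below F" using tops_apply[OF assms] by (simp add: below_def)
    then have "G n \<in> below G" using sub by blast
    then show False using tops_apply[OF assms(2) assms(2)] by (simp add: below_def)
  qed
qed (force simp: below_def intro: order_less_le_trans)

lemma below_inject:
  assumes "F \<in> tops g" "G \<in> tops g" "below F = below G"
  shows "F = G"
  using below_subset_iff[OF assms(1,2)] below_subset_iff[OF assms(2,1)] assms(3)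
  by (auto intro!: ext antisym)

text \<open>Translation of the bead set by \<open>d\<close>, expressed by first gaps: both the
  classes and the gaps move.\<close>

definition shift :: "int \<Rightarrow> (int \<Rightarrow> int) \<Rightarrow> int \<Rightarrow> int" where
  "shift d F n = F (n - d) + d"

lemma shift_tops:
  assumes "F \<in> tops g" shows "shift d F \<in> tops g"
proof -
  have "F (n mod int g - d) = F (n - d)" for n by (rule tops_cong[OF assms]) (rule mod_diff_left_eq)
  moreover have "(F (n - d) + d) mod int g = n mod int g" for n
    using tops_mod[OF assms, of "n - d"] by (metis diff_add_cancel mod_add_left_eq)
  ultimately show ?thesis by (simp add: tops_def shift_def)
qed

lemma below_shift: "below (shift d F) = (+) d ` below F"
proof (intro equalityI subsetI)
  fix m assume "m \<in> below (shift d F)"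
  then show "m \<in> (+) d ` below F"
    by (intro image_eqI[of _ _ "m - d"]) (auto simp: below_def shift_def)
qed (auto simp: below_def shift_def)

lemma below_closed: "F \<in> tops g \<Longrightarrow> x \<in> below F \<Longrightarrow> x - int g \<in> below F"
  using tops_cong[of F g "x - int g" x] by (simp add: below_def)

text \<open>The first gap of each class is found by a \<open>LEAST\<close> search that starts at a
  level \<open>K\<close> where every class still has a bead.\<close>

lemma obtain_tops:
  assumes "0 < g" and L: "{..<L} \<subseteq> B" and M: "B \<subseteq> {..<M}" and closed: "\<And>x. x \<in> B \<Longrightarrow> x - int g \<in> B"
  obtains F where "F \<in> tops g" "B = below F"
proof -
  have down: "x - int g * int k \<in> B" if "x \<in> B" for x k
  proof (induction k)
    case (Suc k) then show ?case using closed[of "x - int g * int k"] by (simp add: algebra_simps)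
  qed (use that in simp)
  \<comment> \<open>The \<open>- 1\<close> leaves room for the remainder:
    \<open>n mod g + g * q < g * (q + 1) \<le> L\<close> for all \<open>q \<le> K\<close>.\<close>
  define K where "K = L div int g - 1"
  define P where "P n k \<longleftrightarrow> n mod int g + int g * (K + int k) \<notin> B" for n k
  define F where "F n = n mod int g + int g * (K + int (LEAST k. P n k))" for n
  have KL: "n mod int g + int g * q \<in> B" if "q \<le> K" for n q
  proof -
    have "int g * (q + 1) \<le> int g * (L div int g)" using that by (intro mult_left_mono) (auto simp: K_def)
    also have "\<dots> \<le> L" using \<open>0 < g\<close> by (metis mult.commute minus_mod_eq_div_mult diff_ge_0_iff_ge
      diff_diff_eq2 add_diff_cancel_left' pos_mod_sign of_nat_0_less_iff)
    finally have "int g * q + int g \<le> L" by (simp add: distrib_left)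
    moreover have "n mod int g < int g" using \<open>0 < g\<close> by simp
    ultimately have "n mod int g + int g * q < L" by linarith
    then show ?thesis using L by blast
  qed
  have ex: "\<exists>k. P n k" for n
  proof (rule exI)
    \<comment> \<open>This makes \<open>K + ?k\<close> both at least \<open>M\<close> and
      nonnegative, so multiplying it by \<open>g \<ge> 1\<close> keeps it at least
      \<open>M\<close>.\<close>
    let ?k = "nat (\<bar>M\<bar> + \<bar>K\<bar>)"
    have "M \<le> K + int ?k" "0 \<le> K + int ?k" by simp_all
    note this(1)
    also have "K + int ?k \<le> int g * (K + int ?k)"
      using mult_right_mono[of 1 "int g" "K + int ?k"] \<open>0 < g\<close> \<open>0 \<le> K + int ?k\<close> by simp
    also have "\<dots> \<le> n mod int g + int g * (K + int ?k)" using \<open>0 < g\<close> by simp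
    finally show "P n ?k" using M by (force simp: P_def)
  qed
  have "F \<in> tops g" by (simp add: tops_def F_def P_def)
  moreover have "m \<in> B \<longleftrightarrow> m < F m" for m
  proof -
    have m: "m = m mod int g + int g * (m div int g)" by simp
    have lt: "m < F m \<longleftrightarrow> m div int g < K + int (LEAST k. P m k)"
      unfolding F_def using \<open>0 < g\<close> by (subst (1) m) (simp only: add_less_cancel_left mult_less_cancel_left_pos of_nat_0_less_iff)
    show ?thesis
    proof (cases "m div int g < K + int (LEAST k. P m k)")
      case True
      have "m mod int g + int g * (m div int g) \<in> B"
      proof (cases "m div int g \<le> K")
        case False
        then have "nat (m div int g - K) < (LEAST k. P m k)" using True by linarith
        from not_less_Least[OF this] show ?thesis using False by (simp add: P_def)
      qed (rule KL)
      then show ?thesis using True lt by simp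
    next
      case False
      have "m \<notin> B"
      proof
        assume "m \<in> B"
        \<comment> \<open>A bead at or beyond the first gap of its class would, by steps of
          \<open>g\<close> downwards, put a bead on that gap.\<close>
        from down[OF this, of "nat (m div int g - K - int (LEAST k. P m k))"] False
        have "m - int g * (m div int g - K - int (LEAST k. P m k)) \<in> B" by simp
        also have "m - int g * (m div int g - K - int (LEAST k. P m k)) =
            (m - int g * (m div int g)) + int g * (K + int (LEAST k. P m k))" by (simp add: algebra_simps)
        also have "m - int g * (m div int g) = m mod int g" by (simp add: minus_mult_div_eq_mod)
        finally show False using LeastI_ex[OF ex[of m]] unfolding P_def by blast
      qed
      then show ?thesis using False lt by simp
    qed
  qed
  then have "B = below F" by (auto simp: below_def)
  ultimately show thesis using that by blast
qed

lemma maya_charge_unique: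
  assumes "maya c X" "maya d X" shows "c = d"
proof -
  obtain L1 M1 where "X \<subseteq> {..<M1}" and L1: "\<And>L. L \<le> L1 \<Longrightarrow> {..<L} \<subseteq> X \<and> finite (X \<inter> {L..}) \<and> int (card (X \<inter> {L..})) = c - L"
    by (rule maya_below[OF assms(1)]) (rule that)
  obtain L2 M2 where "X \<subseteq> {..<M2}" and L2: "\<And>L. L \<le> L2 \<Longrightarrow> {..<L} \<subseteq> X \<and> finite (X \<inter> {L..}) \<and> int (card (X \<inter> {L..})) = d - L"
    by (rule maya_below[OF assms(2)]) (rule that)
  show ?thesis using L1[of "min L1 L2"] L2[of "min L1 L2"] by simp
qed

text \<open>Writing \<open>F n = n + g * q n\<close>, the beads in the class of \<open>n\<close> are
  the \<open>n + g * k\<close> with \<open>k < q n\<close>. The charge is therefore the sum of the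
  levels \<open>q n\<close> over the classes.\<close>

lemma maya_below_tops:
  assumes "0 < g" and F: "F \<in> tops g"
  shows "maya c (below F) \<longleftrightarrow> (\<Sum>n\<in>{0..<int g}. F n) = (\<Sum>n\<in>{0..<int g}. n) + int g * c"
proof -
  have g: "0 < int g" using assms by simp
  define q where "q n = (F n - n) div int g" for n
  have "int g dvd F n - n" for n using tops_mod[OF F, of n] by (simp add: mod_eq_dvd_iff)
  then have Fq: "F n = n + int g * q n" for n by (simp add: q_def)
  \<comment> \<open>The extreme levels: all positions below \<open>g * K\<close> are beads, and none
    from \<open>g * M\<close> on.\<close>
  define K M where "K = Min (q ` {0..<int g})" and "M = Max (q ` {0..<int g})"
  have K: "K \<le> q n" and M: "q n \<le> M" if "n \<in> {0..<int g}" for n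
    using that unfolding K_def M_def by (auto intro!: Min_le Max_ge)
  have mem: "n + int g * k \<in> below F \<longleftrightarrow> k < q n" if "n \<in> {0..<int g}" for n k
  proof -
    have "F (n + int g * k) = F n" by (rule tops_cong[OF F]) simp
    then show ?thesis using g Fq[of n] by (simp add: below_def)
  qed
  have dm: "\<exists>n k. n \<in> {0..<int g} \<and> m = n + int g * k" for m
    by (rule exI[of _ "m mod int g"], rule exI[of _ "m div int g"]) (use g in simp)
  have "below F \<inter> {int g * K..} = (\<lambda>(n, k). n + int g * k) ` (SIGMA n:{0..<int g}. {K..<q n})"
  proof (intro equalityI subsetI)
    fix m assume m: "m \<in> below F \<inter> {int g * K..}"
    obtain n k where nk: "n \<in> {0..<int g}" "m = n + int g * k" using dm by blast
    have "int g * K < int g * (k + 1)" using m nk by (simp add: algebra_simps)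
    then have "K \<le> k" using g by (simp add: mult_less_cancel_left)
    then show "m \<in> (\<lambda>(n, k). n + int g * k) ` (SIGMA n:{0..<int g}. {K..<q n})"
      using nk m mem by (intro image_eqI[of _ _ "(n, k)"]) auto
  next
    fix m assume "m \<in> (\<lambda>(n, k). n + int g * k) ` (SIGMA n:{0..<int g}. {K..<q n})"
    then obtain n k where nk: "n \<in> {0..<int g}" "K \<le> k" "k < q n" "m = n + int g * k" by auto
    moreover have "int g * K \<le> int g * k" using nk g by simp
    then have "int g * K \<le> m" using nk(1,4) by (simp only: atLeastLessThan_iff) linarith
    ultimately show "m \<in> below F \<inter> {int g * K..}" using mem by auto
  qed
  moreover have "inj_on (\<lambda>(n, k). n + int g * k) (SIGMA n:{0..<int g}. {K..<q n})"
  proof (rule inj_onI, clarsimp)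
    fix n k n' k' assume *: "0 \<le> n" "n < int g" "0 \<le> n'" "n' < int g" "n + int g * k = n' + int g * k'"
    have "n = (n + int g * k) mod int g" using *(1,2) by simp
    also have "\<dots> = n'" unfolding *(5) using *(3,4) by simp
    finally have "n = n'" .
    then show "n = n' \<and> k = k'" using * g by simp
  qed
  ultimately have "int (card (below F \<inter> {int g * K..})) = (\<Sum>n\<in>{0..<int g}. q n - K)"
    using K by (simp add: card_image)
  also have "\<dots> = (\<Sum>n\<in>{0..<int g}. q n) - int g * K" by (simp add: sum_subtractf)
  finally have card: "int (card (below F \<inter> {int g * K..})) = (\<Sum>n\<in>{0..<int g}. q n) - int g * K" .
  have "{..<int g * K} \<subseteq> below F"
  proof
    fix m assume "m \<in> {..<int g * K}"
    obtain n k where nk: "n \<in> {0..<int g}" "m = n + int g * k" using dm by blast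
    have "m < int g * K" "0 \<le> n" using \<open>m \<in> {..<int g * K}\<close> nk(1) by simp_all
    then have "int g * k < int g * K" using nk(2) by linarith
    then have "k < K" using g by simp
    then show "m \<in> below F" using nk K[OF nk(1)] mem by simp
  qed
  moreover have "below F \<subseteq> {..<int g * M}"
  proof
    fix m assume "m \<in> below F"
    obtain n k where nk: "n \<in> {0..<int g}" "m = n + int g * k" using dm by blast
    have "k + 1 \<le> M" using \<open>m \<in> below F\<close> nk M[OF nk(1)] mem by simp
    then have "int g * (k + 1) \<le> int g * M" using g by simp
    then show "m \<in> {..<int g * M}" using nk by (simp add: algebra_simps)
  qed
  ultimately have maya: "maya (\<Sum>n\<in>{0..<int g}. q n) (below F)" using card
    unfolding maya_def by (intro exI[of _ "int g * K"] exI[of _ "int g * M"]) simp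
  have "(\<Sum>n\<in>{0..<int g}. F n) = (\<Sum>n\<in>{0..<int g}. n) + int g * (\<Sum>n\<in>{0..<int g}. q n)"
    by (simp only: Fq sum.distrib sum_distrib_left)
  moreover have "maya c (below F) \<longleftrightarrow> c = (\<Sum>n\<in>{0..<int g}. q n)"
    using maya maya_charge_unique by metis
  ultimately show ?thesis using g by auto
qed

section \<open>Bicores in terms of beads\<close>

text \<open>The order of the charges supplies the partner in the exchange: without a bead in
  \<open>Y - X\<close>, \<open>Y\<close> would be contained in \<open>X\<close> and hence equal to
  it.\<close>

lemma bicore_subset:
  assumes p: "p \<in> bicores s c" and c: "fst c \<le> snd c"
  shows "beta (fst c) (fst p) \<subseteq> beta (snd c) (snd p)"
proof (rule ccontr)
  let ?X = "beta (fst c) (fst p)" and ?Y = "beta (snd c) (snd p)"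
  assume "\<not> ?X \<subseteq> ?Y"
  then obtain x where x: "x \<in> ?X" "x \<notin> ?Y" by blast
  have bip: "is_bipartition p" using p by (simp add: bicores_def)
  then have mX: "maya (fst c) ?X" and mY: "maya (snd c) ?Y" by (auto simp: is_bipartition_def maya_beta)
  then obtain y where y: "y \<in> ?Y" "y \<notin> ?X" using maya_antimono_eq[OF mX mY c] x by blast
  obtain lam where lam: "is_partition lam" "beta (fst c) lam = insert y (?X - {x})"
    using maya_obtain_partition[OF maya_swap[OF mX x(1) y(2)]] by blast
  obtain mu where mu: "is_partition mu" "beta (snd c) mu = insert x (?Y - {y})"
    using maya_obtain_partition[OF maya_swap[OF mY y(1) x(2)]] by blast
  have bip': "is_bipartition (lam, mu)" using lam mu by (simp add: is_bipartition_def)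
  have "bead_count c (lam, mu) = bead_count c p"
    using x y lam mu by (auto simp: bead_count_def fun_eq_iff)
  then have "content s c (lam, mu) = content s c p"
    by (rule bead_count_eq_imp_content_eq[OF bip' bip])
  then have "(lam, mu) = p" using p bip' by (auto simp: bicores_def)
  then show False using lam x y by auto
qed

text \<open>Residues modulo \<open>s\<close> do not notice the extra \<open>s\<close> in the charge.
  It makes the exchange available for the pair \<open>Y\<close>, \<open>X + s\<close>.\<close>

lemma content_swap:
  assumes "is_bipartition p"
  shows "content s (c2, c1 + int s) (prod.swap p) = content s (c1, c2) p"
proof -
  define r :: "nat \<times> nat \<times> nat \<Rightarrow> nat \<times> nat \<times> nat" where "r = (\<lambda>(i, j, k). (i, j, 3 - k))"
  have "nodes (prod.swap p) = r ` nodes p"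
    by (fastforce simp: nodes_def r_def image_iff)
  moreover have "inj_on r (nodes p)" by (auto simp: inj_on_def r_def nodes_def)
  ultimately have "mset_set (nodes (prod.swap p)) = image_mset r (mset_set (nodes p))"
    by (simp add: image_mset_mset_set)
  then have "content s (c2, c1 + int s) (prod.swap p) =
      image_mset (\<lambda>n. residue s (c2, c1 + int s) (r n)) (mset_set (nodes p))"
    by (simp add: content_def multiset.map_comp comp_def)
  also have "\<dots> = content s (c1, c2) p"
    unfolding content_def
  proof (rule image_mset_cong)
    fix n assume "n \<in># mset_set (nodes p)"
    then have "n \<in> nodes p" using finite_nodes[OF assms] by simp
    then show "residue s (c2, c1 + int s) (r n) = residue s (c1, c2) n"
      by (auto simp: nodes_def residue_def r_def) (metis add.assoc mod_add_self2)
  qed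
  finally show ?thesis .
qed

lemma bicores_swap:
  assumes "p \<in> bicores s (c1, c2)"
  shows "prod.swap p \<in> bicores s (c2, c1 + int s)"
  unfolding bicores_def
proof (intro CollectI conjI allI impI)
  have p: "is_bipartition p" using assms by (simp add: bicores_def)
  then show "is_bipartition (prod.swap p)" by (simp add: is_bipartition_def)
  fix q assume q: "is_bipartition q \<and> content s (c2, c1 + int s) q = content s (c2, c1 + int s) (prod.swap p)"
  then have q': "is_bipartition (prod.swap q)" by (simp add: is_bipartition_def)
  have "content s (c1, c2) (prod.swap q) = content s (c1, c2) p"
    using q content_swap[OF p] content_swap[OF q', of s c2 c1] by simp
  then have "prod.swap q = p" using assms q' unfolding bicores_def by blast
  then show "q = prod.swap p" by auto
qed

text \<open>Every class modulo \<open>s\<close> holds beads in both components below \<open>F\<close> and in neither above, so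
  the bead count minimises the sum of \<open>b - F b\<close> over all beads, with equality only if it agrees
  off the points \<open>b = F b\<close>; the number of beads in each class then settles these as well.\<close>

lemma subset_bicore:
  assumes "0 < s" and p: "is_bipartition p"
    and XY: "beta (fst c) (fst p) \<subseteq> beta (snd c) (snd p)"
    and YX: "\<And>y. y \<in> beta (snd c) (snd p) \<Longrightarrow> y - int s \<in> beta (fst c) (fst p)"
  shows "p \<in> bicores s c"
  unfolding bicores_def
proof (intro CollectI conjI allI impI p)
  fix q assume q: "is_bipartition q \<and> content s c q = content s c p"
  let ?X = "beta (fst c) (fst p)" and ?Y = "beta (snd c) (snd p)"
  let ?w = "bead_count c p" and ?w' = "bead_count c q"
  have parts: "is_partition (fst p)" "is_partition (snd p)" "is_partition (fst q)" "is_partition (snd q)"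
    using p q by (auto simp: is_bipartition_def)
  obtain L1 M1 where LM1: "{..<L1} \<subseteq> ?X" "?X \<subseteq> {..<M1}"
    using maya_beta[OF parts(1), of "fst c"] unfolding maya_def by blast
  obtain F where F: "F \<in> tops s" and XF: "?X = below F"
    using obtain_tops[OF \<open>0 < s\<close> LM1] XY YX by blast
  obtain L M where LM: "\<And>b. b \<notin> {L..<M} \<Longrightarrow> ?w' b = ?w b" and
    diff: "\<And>f. (\<Sum>b\<in>{L..<M}. (?w' b - ?w b) * f b) =
       (\<Sum>n\<in>nodes q. f (node_content c n) - f (node_content c n - 1)) -
       (\<Sum>n\<in>nodes p. f (node_content c n) - f (node_content c n - 1) :: int)"
    using q p by (elim conjE) (rule bead_count_diff_sum[of q p c], assumption, assumption, rule that)
  \<comment> \<open>The increments of \<open>f\<close> depend only on residues, so both bipartitions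
    have the same bead sum of \<open>f\<close>.\<close>
  have zero: "(\<Sum>b\<in>{L..<M}. (?w' b - ?w b) * f b) = 0"
    if "\<And>k. f k - f (k - 1) = h (k mod int s)" for f h :: "int \<Rightarrow> int"
    unfolding diff that using content_eq_imp_sum_eq[of s c q p h] q p by simp
  have Fs: "F (k - 1) = F (k mod int s - 1)" "F k = F (k mod int s)" for k
    by (rule tops_cong[OF F], simp add: mod_diff_left_eq)+
  have w2: "?w b = 2" if "b < F b" for b
    using that XF XY by (auto simp: bead_count_def below_def)
  have w0: "?w b = 0" if "F b < b" for b
  proof -
    have "F (b - int s) = F b" by (rule tops_cong[OF F]) simp
    \<comment> \<open>Since \<open>b\<close> is congruent to \<open>F b\<close>, it is at least
      \<open>F b + s\<close>; so \<open>b - s\<close> is at or past the first gap of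
      \<open>X\<close>, and then \<open>b\<close> cannot be in \<open>Y\<close>.\<close>
    moreover have "b - int s \<notin> ?X"
    proof
      assume "b - int s \<in> ?X"
      then have "F b < b" "b < F b + int s" using XF \<open>F (b - int s) = F b\<close> that by (auto simp: below_def)
      then have "(b - F b) mod int s = b - F b" by simp
      moreover have "(b - F b) mod int s = 0" using tops_mod[OF F, of b] by (metis mod_eq_dvd_iff dvd_imp_mod_0)
      ultimately show False using that by simp
    qed
    ultimately show ?thesis using YX[of b] XY that XF by (auto simp: bead_count_def)
  qed
  have range: "0 \<le> ?w' b \<and> ?w' b \<le> 2" for b by (simp add: bead_count_def)
  have nonneg: "0 \<le> (?w' b - ?w b) * (b - F b)" for b
    using w2[of b] w0[of b] range[of b]
    by (cases b "F b" rule: linorder_cases) (auto intro: mult_nonneg_nonneg mult_nonpos_nonpos)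
  \<comment> \<open>The increment of \<open>b - F b\<close> at \<open>k\<close> is
    \<open>1 - F k + F (k - 1)\<close>, a function of \<open>k mod s\<close>.\<close>
  have "(\<Sum>b\<in>{L..<M}. (?w' b - ?w b) * (b - F b)) = 0"
    by (rule zero[of _ "\<lambda>r. 1 - F r + F (r - 1)"]) (simp add: Fs[symmetric])
  then have "(?w' b - ?w b) * (b - F b) = 0" if "b \<in> {L..<M}" for b
    using that nonneg by (subst (asm) sum_nonneg_eq_0_iff) auto
  then have off: "?w' b = ?w b" if "b \<noteq> F b" for b
    using that LM[of b] by (cases "b \<in> {L..<M}") auto
  have "?w' b = ?w b" for b
  proof (cases "b = F b \<and> b \<in> {L..<M}")
    case True
    \<comment> \<open>Every other \<open>a\<close> in the class has
      \<open>F a = b \<noteq> a\<close>, where the counts already agree; only the term at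
      \<open>b\<close> survives.\<close>
    have "(\<Sum>a\<in>{L..<M}. (?w' a - ?w a) * of_bool (a mod int s = b mod int s)) = 0"
      by (rule zero[of _ "\<lambda>r. of_bool (r = b mod int s) - of_bool ((r - 1) mod int s = b mod int s)"])
        (simp add: mod_diff_left_eq)
    moreover have "(?w' a - ?w a) * of_bool (a mod int s = b mod int s) = (if a = b then ?w' b - ?w b else 0)" for a
    proof (cases "a \<noteq> b \<and> a mod int s = b mod int s")
      case same: True
      then have "F a = F b" using tops_cong[OF F] by blast
      then show ?thesis using same True off[of a] by simp
    qed auto
    ultimately show ?thesis using True by simp
  next
    case False
    then show ?thesis using off LM by blast
  qed
  then have eq: "of_bool (b \<in> beta (fst c) (fst q)) + of_bool (b \<in> beta (snd c) (snd q)) =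
      (of_bool (b \<in> ?X) + of_bool (b \<in> ?Y) :: int)" for b
    by (simp add: bead_count_def)
  \<comment> \<open>A bead of \<open>X\<close> is also in \<open>Y\<close> and has count 2, so both
    components of \<open>q\<close> contain it. Equal charges then turn the inclusion into
    equality.\<close>
  have "?X \<subseteq> beta (fst c) (fst q)"
  proof
    fix b assume "b \<in> ?X"
    then show "b \<in> beta (fst c) (fst q)" using eq[of b] XY by (auto simp: of_bool_def split: if_splits)
  qed
  then have Xeq: "beta (fst c) (fst q) = ?X"
    using maya_antimono_eq maya_beta parts by blast
  then have "b \<in> beta (snd c) (snd q) \<longleftrightarrow> b \<in> ?Y" for b using eq[of b] by (simp add: of_bool_def split: if_splits)
  then have "beta (snd c) (snd q) = ?Y" by blast
  then show "q = p" using Xeq beta_inject parts by (metis prod.expand)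
qed

text \<open>The two bounds on \<open>c2\<close> are the charge inequalities that the exchange
  requires for \<open>X\<close>, \<open>Y\<close> and for \<open>Y\<close>,
  \<open>X + s\<close>.\<close>

lemma bicores_iff:
  assumes "0 < s" and "is_bipartition p" and "c1 \<le> c2" and "c2 \<le> c1 + int s"
  shows "p \<in> bicores s (c1, c2) \<longleftrightarrow> beta c1 (fst p) \<subseteq> beta c2 (snd p) \<and>
    beta c2 (snd p) \<subseteq> (+) (int s) ` beta c1 (fst p)"
proof
  assume p: "p \<in> bicores s (c1, c2)"
  show "beta c1 (fst p) \<subseteq> beta c2 (snd p) \<and> beta c2 (snd p) \<subseteq> (+) (int s) ` beta c1 (fst p)"
    using bicore_subset[OF p] bicore_subset[OF bicores_swap[OF p]] assms by (simp add: beta_shift)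
next
  assume "beta c1 (fst p) \<subseteq> beta c2 (snd p) \<and> beta c2 (snd p) \<subseteq> (+) (int s) ` beta c1 (fst p)"
  then show "p \<in> bicores s (c1, c2)"
    by (intro subset_bicore[OF assms(1,2)]) auto
qed

section \<open>Counting pairs of cores\<close>

lemma sum_periodic_shift:
  fixes f :: "int \<Rightarrow> int"
  assumes "0 < g" and f: "\<And>n. f (n mod int g) = f n"
  shows "(\<Sum>n\<in>{0..<int g}. f (n + d)) = (\<Sum>n\<in>{0..<int g}. f n)"
proof (rule sum.reindex_bij_witness[of _ "\<lambda>n. (n - d) mod int g" "\<lambda>n. (n + d) mod int g"])
  fix n assume "n \<in> {0..<int g}"
  then show "((n + d) mod int g - d) mod int g = n" "((n - d) mod int g + d) mod int g = n"
    by (simp_all add: mod_diff_left_eq mod_add_left_eq)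
qed (use assms in auto)

lemma sum_shift:
  assumes "0 < g" "F \<in> tops g"
  shows "(\<Sum>n\<in>{0..<int g}. shift d F n) = (\<Sum>n\<in>{0..<int g}. F n) + int g * d"
  using sum_periodic_shift[of g F "- d"] assms by (simp add: shift_def sum.distrib tops_def)

text \<open>The core condition on first gaps, where \<open>shift a\<close> takes the second
  component from charge 0 to its charge \<open>a\<close>.\<close>

definition sandwich :: "nat \<Rightarrow> int \<Rightarrow> (int \<Rightarrow> int) \<Rightarrow> (int \<Rightarrow> int) \<Rightarrow> bool" where
  "sandwich s a F G \<longleftrightarrow> (\<forall>n. F n \<le> shift a G n \<and> shift a G n \<le> F n + int s)"

text \<open>The number of steps of size \<open>g\<close> from the first gap in one bead set to the
  first gap of the same class in the other.\<close>

definition gap :: "nat \<Rightarrow> int \<Rightarrow> (int \<Rightarrow> int) \<Rightarrow> (int \<Rightarrow> int) \<Rightarrow> int \<Rightarrow> int" where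
  "gap g a F G = restrict (\<lambda>n. (shift a G n - F n) div int g) {0..<int g}"

lemma tops_diff_dvd: "F \<in> tops g \<Longrightarrow> G \<in> tops g \<Longrightarrow> int g dvd G n - F n"
  by (metis mod_eq_dvd_iff tops_mod)

lemma gap_mult:
  assumes "0 < g" "F \<in> tops g" "G \<in> tops g"
  shows "int g * gap g a F G (n mod int g) = shift a G n - F n"
proof -
  have "shift a G (n mod int g) = shift a G n" "F (n mod int g) = F n"
    using assms shift_tops[of G g a] by (auto simp: tops_def)
  then show ?thesis
    using assms tops_diff_dvd[OF assms(2) shift_tops[OF assms(3), of a], of n] by (simp add: gap_def)
qed

text \<open>The sum of the entries is automatically \<open>a\<close>: both bead sets start with the
  same charge, and the translation by \<open>a\<close> adds \<open>g * a\<close> to the sum of first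
  gaps. Only the bounds carry information, and they are the two inclusions.\<close>

lemma gap_in_U_funs_iff:
  assumes "0 < g" "F \<in> tops g" "G \<in> tops g" "g dvd s"
    and sums: "(\<Sum>n\<in>{0..<int g}. F n) = (\<Sum>n\<in>{0..<int g}. G n)"
  shows "gap g a F G \<in> U_funs g s a \<longleftrightarrow> sandwich s a F G"
proof -
  have g: "0 < int g" using assms by simp
  have gap: "int g * gap g a F G n = shift a G n - F n" if "n \<in> {0..<int g}" for n
    using gap_mult[OF assms(1-3), of a n] that by simp
  have "int g * (\<Sum>n\<in>{0..<int g}. gap g a F G n) = (\<Sum>n\<in>{0..<int g}. shift a G n - F n)"
    unfolding sum_distrib_left by (intro sum.cong refl gap)
  also have "\<dots> = int g * a" using sums sum_shift[OF assms(1,3), of a] by (simp add: sum_subtractf)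
  finally have sum: "(\<Sum>n\<in>{0..<int g}. gap g a F G n) = a" using g by simp
  have s: "int s = int g * int (s div g)" using \<open>g dvd s\<close> by (metis dvd_mult_div_cancel of_nat_mult)
  have bound: "0 \<le> gap g a F G (n mod int g) \<and> gap g a F G (n mod int g) \<le> int (s div g) \<longleftrightarrow>
      F n \<le> shift a G n \<and> shift a G n \<le> F n + int s" for n
  proof -
    have "F n \<le> shift a G n \<longleftrightarrow> int g * 0 \<le> int g * gap g a F G (n mod int g)"
      using gap_mult[OF assms(1-3), of a n] by simp
    moreover have "shift a G n \<le> F n + int s \<longleftrightarrow> int g * gap g a F G (n mod int g) \<le> int g * int (s div g)"
      using gap_mult[OF assms(1-3), of a n] s by linarith
    ultimately show ?thesis using g by (simp only: mult_le_cancel_left_pos)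
  qed
  have "(\<forall>n\<in>{0..<int g}. 0 \<le> gap g a F G n \<and> gap g a F G n \<le> int (s div g)) \<longleftrightarrow> sandwich s a F G"
  proof
    assume *: "\<forall>n\<in>{0..<int g}. 0 \<le> gap g a F G n \<and> gap g a F G n \<le> int (s div g)"
    show "sandwich s a F G" unfolding sandwich_def
    proof
      fix n
      have "n mod int g \<in> {0..<int g}" using g by simp
      with * bound[of n] show "F n \<le> shift a G n \<and> shift a G n \<le> F n + int s" by blast
    qed
  next
    assume "sandwich s a F G"
    then have "0 \<le> gap g a F G (n mod int g) \<and> gap g a F G (n mod int g) \<le> int (s div g)" for n
      unfolding bound sandwich_def by blast
    then show "\<forall>n\<in>{0..<int g}. 0 \<le> gap g a F G n \<and> gap g a F G n \<le> int (s div g)"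
      by (metis atLeastLessThan_iff mod_pos_pos_trivial)
  qed
  moreover have "gap g a F G \<in> {0..<int g} \<rightarrow>\<^sub>E UNIV" by (simp add: gap_def)
  ultimately show ?thesis using sum by (simp add: U_funs_def)
qed

section \<open>Recovering the first gaps from their differences\<close>

lemma coprime_periods_imp_const:
  fixes D :: "int \<Rightarrow> 'a"
  assumes "coprime (int g) d" and g: "\<And>n. D (n mod int g) = D n" and d: "\<And>n. D (n + d) = D n"
  shows "D n = D 0"
proof -
  obtain u v where uv: "u * int g + v * d = 1"
    using bezout_int[of "int g" d] assms(1) by (auto simp: coprime_iff_gcd_eq_1)
  have mult: "D (k * d) = D 0" for k
  proof (induction k rule: int_induct[where k = 0])
    case (step1 i) then show ?case using d[of "i * d"] by (simp add: algebra_simps)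
  next
    case (step2 i) then show ?case using d[of "(i - 1) * d"] by (simp add: algebra_simps)
  qed simp
  \<comment> \<open>By Bezout, \<open>n\<close> is congruent modulo \<open>g\<close> to a multiple
    of \<open>d\<close>.\<close>
  have "n = n * v * d + n * u * int g" using arg_cong[OF uv, of "\<lambda>x. n * x"] by (simp add: algebra_simps)
  then have "n mod int g = (n * v * d + n * u * int g) mod int g" by (rule arg_cong)
  then have "n mod int g = (n * v * d) mod int g" by simp
  then have "D n = D (n * v * d)" using g[of n] g[of "n * v * d"] by simp
  then show ?thesis using mult by simp
qed

text \<open>Let \<open>D\<close> and \<open>E\<close> be the changes in \<open>F\<close> and
  \<open>G\<close>. Equal differences say \<open>E (n - a) = D n = E (n - b)\<close>, so
  \<open>D\<close> has period \<open>a - b\<close> besides \<open>g\<close> and is constant.\<close>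

lemma gap_inject:
  assumes "0 < g" "coprime (int g) (a - b)"
    and "F \<in> tops g" "G \<in> tops g" "F' \<in> tops g" "G' \<in> tops g"
    and a: "gap g a F G = gap g a F' G'" and b: "gap g b F G = gap g b F' G'"
  obtains k where "\<And>n. F' n = F n + int g * k" "\<And>n. G' n = G n + int g * k"
proof -
  define D where "D n = F' n - F n" for n
  define E where "E n = G' n - G n" for n
  have DE: "E (n - a) = D n" "E (n - b) = D n" for n
    using gap_mult[OF assms(1,3,4), of a n] gap_mult[OF assms(1,5,6), of a n]
      gap_mult[OF assms(1,3,4), of b n] gap_mult[OF assms(1,5,6), of b n] a b
    by (auto simp: shift_def D_def E_def)
  have "D n = D 0" for n
  proof (rule coprime_periods_imp_const[OF assms(2)])
    show "D (n mod int g) = D n" for n using assms by (simp add: D_def tops_def)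
    show "D (n + (a - b)) = D n" for n using DE(1)[of "n + (a - b)"] DE(2)[of n] by simp
  qed
  moreover have "int g * (D 0 div int g) = D 0"
    using tops_diff_dvd[OF assms(3,5), of 0] by (simp add: D_def)
  moreover have "E n = D (n + a)" for n using DE(1)[of "n + a"] by simp
  ultimately have "F' n = F n + int g * (D 0 div int g)" "G' n = G n + int g * (D 0 div int g)" for n
    by (metis D_def E_def add.commute diff_add_cancel)+
  then show thesis using that by blast
qed

text \<open>Since \<open>d\<close> is a unit modulo \<open>g\<close>, the recursion runs once through all classes; the sum
  condition closes the cycle.\<close>

lemma obtain_tops_increments:
  assumes "0 < g" "coprime (int g) d"
    and per: "\<And>n. w (n mod int g) = w n" and cong: "\<And>n. w n mod int g = d mod int g"
    and sum0: "(\<Sum>n\<in>{0..<int g}. w n) = 0"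
  obtains F where "F \<in> tops g" "\<And>n. F (n + d) = F n + w n"
proof -
  have g: "0 < int g" using assms by simp
  obtain u e where "u * int g + e * d = 1"
    using bezout_int[of "int g" d] assms(2) by (auto simp: coprime_iff_gcd_eq_1)
  then have e: "(e * d) mod int g = 1 mod int g" by (metis mod_mult_self3)
  have ed: "(e * d * x) mod int g = x mod int g" for x
    using e by (metis mod_mult_left_eq mult_1)
  have unit: "((e * x) mod int g * d) mod int g = x mod int g" for x
    using ed[of x] mod_mult_left_eq[of "e * x" "int g" d] by (simp only: ac_simps)
  \<comment> \<open>As \<open>e\<close> inverts \<open>d\<close> modulo \<open>g\<close>,
    \<open>k m\<close> is the number of steps \<open>d\<close> leading from class 0 to the class of
    \<open>m\<close>.\<close>
  define k where "k m = nat ((e * m) mod int g)" for m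
  have k: "int (k m) = (e * m) mod int g" for m using g by (simp add: k_def)
  define F where "F m = (\<Sum>i<k m. w (int i * d))" for m
  have wk: "w (int (k m) * d) = w m" for m
    using per[of m] per[of "int (k m) * d"] unit[of m] by (simp add: k)
  have "(\<Sum>i<j. w (int i * d)) mod int g = (int j * d) mod int g" for j
  proof (induction j)
    case (Suc j)
    have "(\<Sum>i<Suc j. w (int i * d)) mod int g = ((int j * d) mod int g + d mod int g) mod int g"
      using Suc cong[of "int j * d"] by (metis mod_add_eq sum.lessThan_Suc)
    then show ?case by (simp add: mod_add_eq algebra_simps)
  qed simp
  then have "F m mod int g = m mod int g" for m using unit by (simp add: F_def k)
  moreover have "F (m mod int g) = F m" for m by (simp add: F_def k_def mod_mult_right_eq)
  ultimately have "F \<in> tops g" by (simp add: tops_def)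
  have cycle: "(\<Sum>i<g. w (int i * d)) = 0"
  proof -
    have "(\<Sum>i<g. w (int i * d)) = (\<Sum>n\<in>{0..<int g}. w n)"
    proof (rule sum.reindex_bij_witness[of _ k "\<lambda>i. (int i * d) mod int g"])
      fix i assume "i \<in> {..<g}"
      then have "(e * (int i * d)) mod int g = int i" using ed[of "int i"] by (simp add: ac_simps)
      then show "k ((int i * d) mod int g) = i" by (simp add: k_def mod_mult_right_eq)
    next
      fix n assume n: "n \<in> {0..<int g}"
      then show "(int (k n) * d) mod int g = n" using unit[of n] by (simp add: k)
      show "k n \<in> {..<g}" using k[of n] pos_mod_bound[OF g, of "e * n"] by (simp only: lessThan_iff)
    qed (use g per in auto)
    then show ?thesis using sum0 by simp
  qed
  have "F (m + d) = F m + w m" for m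
  proof -
    have kd: "int (k (m + d)) = (int (k m) + 1) mod int g"
    proof -
      have "(e * (m + d)) mod int g = ((e * m) mod int g + (e * d) mod int g) mod int g"
        by (simp add: distrib_left mod_add_eq)
      then show ?thesis unfolding k e by (simp add: mod_add_right_eq)
    qed
    have "k m < g" using k[of m] pos_mod_bound[OF g, of "e * m"] by linarith
    then consider "Suc (k m) < g" | "Suc (k m) = g" by linarith
    then show ?thesis
    proof cases
      case 1
      then have "k (m + d) = Suc (k m)" using kd by simp
      then show ?thesis by (simp add: F_def wk)
    next
      case 2
      then have "int (k m) + 1 = int g" by simp
      then have "k (m + d) = 0" using kd by simp
      moreover have "F m + w m = (\<Sum>i<Suc (k m). w (int i * d))" by (simp add: F_def wk)
      ultimately show ?thesis using cycle 2 by (simp add: F_def)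
    qed
  qed
  then show thesis using that \<open>F \<in> tops g\<close> by blast
qed

lemma tops_add: "F \<in> tops g \<Longrightarrow> (\<lambda>n. F n + int g * k) \<in> tops g"
  by (simp add: tops_def)

lemma U_funs_sum: "u \<in> U_funs g s a \<Longrightarrow> (\<Sum>n\<in>{0..<int g}. u (n mod int g)) = a"
  by (simp add: U_funs_def)

text \<open>The equation for \<open>u\<close> expresses \<open>G\<close> by \<open>F\<close>;
  inserting this into the equation for \<open>v\<close> leaves \<open>F (n + d) = F n + w n\<close>.
  Over all classes \<open>w\<close> sums to \<open>g * (b - a) + g * d = 0\<close>, so the recursion
  can be solved.\<close>

lemma gap_surj:
  assumes "0 < g" "coprime (int g) (a - b)" and u: "u \<in> U_funs g s a" and v: "v \<in> U_funs g t b"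
  obtains F G j where "F \<in> tops g" "G \<in> tops g" "j \<in> {0..<int g}"
    "(\<Sum>n\<in>{0..<int g}. F n) = (\<Sum>n\<in>{0..<int g}. n) + int g * j"
    "(\<Sum>n\<in>{0..<int g}. G n) = (\<Sum>n\<in>{0..<int g}. n) + int g * j"
    "gap g a F G = u" "gap g b F G = v"
proof -
  have g: "0 < int g" using assms by simp
  define u' where "u' n = u (n mod int g)" for n
  define v' where "v' n = v (n mod int g)" for n
  define d where "d = a - b"
  define w where "w n = int g * (v' n - u' (n + d)) + d" for n
  have per: "u' (n mod int g) = u' n" "v' (n mod int g) = v' n" "u' (n mod int g + x) = u' (n + x)" for n x
    by (simp_all add: u'_def v'_def mod_add_left_eq)
  have sums: "(\<Sum>n\<in>{0..<int g}. u' (n + x)) = a" "(\<Sum>n\<in>{0..<int g}. v' n) = b" for x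
    using sum_periodic_shift[of g u' x, OF \<open>0 < g\<close> per(1)] U_funs_sum[OF u] U_funs_sum[OF v]
    by (simp_all add: u'_def v'_def)
  obtain F where F: "F \<in> tops g" and step: "\<And>n. F (n + d) = F n + w n"
  proof (rule obtain_tops_increments[of g d w])
    show "w (n mod int g) = w n" "w n mod int g = d mod int g" for n
      by (simp_all add: w_def per)
    have "(\<Sum>n\<in>{0..<int g}. w n) = int g * (b - a) + int g * d"
      by (simp add: w_def sum.distrib sum_subtractf sums flip: sum_distrib_left)
    then show "(\<Sum>n\<in>{0..<int g}. w n) = 0" by (simp add: d_def algebra_simps)
  qed (use assms d_def in auto)
  define G where "G n = int g * u' (n + a) + F (n + a) - a" for n
  have Fa: "F (n mod int g + a) = F (n + a)" for n by (rule tops_cong[OF F]) (simp add: mod_add_left_eq)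
  have "G n mod int g = n mod int g" for n
  proof -
    have "G n mod int g = (F (n + a) - a) mod int g" by (simp add: G_def add_diff_eq[symmetric])
    also have "\<dots> = (F (n + a) mod int g - a) mod int g" by (simp add: mod_diff_left_eq)
    also have "\<dots> = n mod int g" unfolding tops_mod[OF F] by (simp add: mod_diff_left_eq)
    finally show ?thesis .
  qed
  then have G: "G \<in> tops g" by (simp add: tops_def G_def per Fa)
  define q where "q = (\<Sum>n\<in>{0..<int g}. (F n - n) div int g)"
  have "int g * ((F n - n) div int g) = F n - n" for n
    using tops_mod[OF F, of n] by (simp add: mod_eq_dvd_iff)
  then have sumF: "(\<Sum>n\<in>{0..<int g}. F n) = (\<Sum>n\<in>{0..<int g}. n) + int g * q"
    by (simp add: q_def sum_distrib_left sum_subtractf)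
  have "(\<Sum>n\<in>{0..<int g}. F (n + a)) = (\<Sum>n\<in>{0..<int g}. F n)"
    by (rule sum_periodic_shift[OF \<open>0 < g\<close>]) (use F in \<open>simp add: tops_def\<close>)
  then have sumG: "(\<Sum>n\<in>{0..<int g}. G n) = (\<Sum>n\<in>{0..<int g}. F n)"
    by (simp add: G_def sum.distrib sum_subtractf sums flip: sum_distrib_left)
  \<comment> \<open>Adding \<open>g * k\<close> to both functions leaves the differences alone and
    moves the charge \<open>q\<close> to its remainder modulo \<open>g\<close>.\<close>
  define k where "k = - (q div int g)"
  have qk: "q + int g * k = q mod int g" by (simp add: k_def minus_mult_div_eq_mod)
  let ?F = "\<lambda>n. F n + int g * k" and ?G = "\<lambda>n. G n + int g * k"
  show thesis
  proof (rule that[of ?F ?G "q mod int g"])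
    show "?F \<in> tops g" "?G \<in> tops g" using F G by (simp_all add: tops_add)
    show "q mod int g \<in> {0..<int g}" using g by simp
    show "(\<Sum>n\<in>{0..<int g}. ?F n) = (\<Sum>n\<in>{0..<int g}. n) + int g * (q mod int g)"
      unfolding qk[symmetric] by (simp add: sum.distrib sumF algebra_simps)
    then show "(\<Sum>n\<in>{0..<int g}. ?G n) = (\<Sum>n\<in>{0..<int g}. n) + int g * (q mod int g)"
      by (simp add: sum.distrib sumG)
    have "shift a ?G n - ?F n = int g * u' n" for n by (simp add: shift_def G_def)
    then show "gap g a ?F ?G = u"
      using u g by (auto simp: gap_def u'_def U_funs_def PiE_iff extensional_def fun_eq_iff)
    have "shift b ?G n - ?F n = int g * v' n" for n
      using step[of n] by (simp add: shift_def G_def w_def d_def algebra_simps)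
    then show "gap g b ?F ?G = v"
      using v g by (auto simp: gap_def v'_def U_funs_def PiE_iff extensional_def fun_eq_iff)
  qed
qed

text \<open>Bipartitions correspond to \<open>c = 0\<close>; the common charge is a parameter so
  that charges can be averaged.\<close>

definition core_pairs :: "nat \<Rightarrow> nat \<Rightarrow> int \<Rightarrow> nat \<Rightarrow> int \<Rightarrow> int \<Rightarrow> ((int \<Rightarrow> int) \<times> (int \<Rightarrow> int)) set" where
  "core_pairs g s a t b c = {(F, G). F \<in> tops g \<and> G \<in> tops g \<and> sandwich s a F G \<and> sandwich t b F G \<and>
     (\<Sum>n\<in>{0..<int g}. F n) = (\<Sum>n\<in>{0..<int g}. n) + int g * c \<and>
     (\<Sum>n\<in>{0..<int g}. G n) = (\<Sum>n\<in>{0..<int g}. n) + int g * c}"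

lemma shift_shift: "shift d (shift e F) = shift (d + e) F"
  by (auto simp: shift_def fun_eq_iff algebra_simps)

lemma shift_0 [simp]: "shift 0 F = F"
  by (simp add: shift_def fun_eq_iff)

lemma sandwich_shift:
  assumes "sandwich s a F G" shows "sandwich s a (shift d F) (shift d G)"
proof -
  have "F (n - d) \<le> shift a G (n - d) \<and> shift a G (n - d) \<le> F (n - d) + int s" for n
    using assms unfolding sandwich_def by blast
  then show ?thesis by (simp add: sandwich_def shift_def algebra_simps)
qed

lemma core_pairs_shift:
  assumes "0 < g" "(F, G) \<in> core_pairs g s a t b c"
  shows "(shift d F, shift d G) \<in> core_pairs g s a t b (c + d)"
  using assms by (auto simp: core_pairs_def shift_tops sandwich_shift sum_shift algebra_simps)

text \<open>A pair \<open>(u, v)\<close> fixes \<open>(F, G)\<close> up to a common multiple of \<open>g\<close>, hence exactly one pair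
  whose charge lies in \<open>{0..<g}\<close>; shifting shows that each of these \<open>g\<close> charges occurs
  equally often.\<close>

lemma card_core_pairs:
  assumes "0 < g" "coprime (int g) (a - b)" "g dvd s" "g dvd t"
  shows "g * card (core_pairs g s a t b 0) = card (U_funs g s a) * card (U_funs g t b)"
proof -
  have g: "0 < int g" using assms by simp
  let ?Q = "core_pairs g s a t b"
  let ?f = "\<lambda>((F, G), j). (shift j F, shift j G)"
  let ?h = "\<lambda>(F, G). (gap g a F G, gap g b F G)"
  have charge: "c = c'" if "(F, G) \<in> ?Q c" "(F, G) \<in> ?Q c'" for F G c c'
    using that g by (simp add: core_pairs_def)
  have "bij_betw ?f (?Q 0 \<times> {0..<int g}) (\<Union>j\<in>{0..<int g}. ?Q j)"
  proof (rule bij_betw_imageI)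
    show "inj_on ?f (?Q 0 \<times> {0..<int g})"
    proof (rule inj_onI)
      fix x y assume x: "x \<in> ?Q 0 \<times> {0..<int g}" and y: "y \<in> ?Q 0 \<times> {0..<int g}" and xy: "?f x = ?f y"
      obtain F G j F' G' j' where xy': "x = ((F, G), j)" "y = ((F', G'), j')" by (metis prod.exhaust)
      then have FG: "(F, G) \<in> ?Q 0" "(F', G') \<in> ?Q 0"
        and eq: "shift j F = shift j' F'" "shift j G = shift j' G'" using x y xy by auto
      \<comment> \<open>The charge of the common image is both \<open>j\<close> and
        \<open>j'\<close>.\<close>
      have jj: "j = j'"
        using core_pairs_shift[OF \<open>0 < g\<close> FG(1), of j] core_pairs_shift[OF \<open>0 < g\<close> FG(2), of j'] eq charge by simp
      have cancel: "shift (- j) (shift j H) = H" for H by (simp add: shift_shift)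
      have "F = F'" "G = G'" using eq jj cancel by metis+
      then show "x = y" using xy' jj by simp
    qed
    show "?f ` (?Q 0 \<times> {0..<int g}) = (\<Union>j\<in>{0..<int g}. ?Q j)"
    proof (intro equalityI subsetI)
      fix x assume "x \<in> ?f ` (?Q 0 \<times> {0..<int g})"
      then obtain F G j where "(F, G) \<in> ?Q 0" "j \<in> {0..<int g}" "x = (shift j F, shift j G)" by auto
      then show "x \<in> (\<Union>j\<in>{0..<int g}. ?Q j)" using core_pairs_shift[OF \<open>0 < g\<close>, of F G s a t b 0 j] by auto
    next
      fix x assume "x \<in> (\<Union>j\<in>{0..<int g}. ?Q j)"
      then obtain F G j where FG: "(F, G) \<in> ?Q j" "j \<in> {0..<int g}" "x = (F, G)" by (cases x) auto
      then have "(shift (- j) F, shift (- j) G) \<in> ?Q 0"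
        using core_pairs_shift[OF \<open>0 < g\<close>, of F G s a t b j "- j"] by simp
      then show "x \<in> ?f ` (?Q 0 \<times> {0..<int g})" using FG
        by (intro image_eqI[of _ _ "((shift (- j) F, shift (- j) G), j)"]) (auto simp: shift_shift)
    qed
  qed
  then have card1: "card (?Q 0 \<times> {0..<int g}) = card (\<Union>j\<in>{0..<int g}. ?Q j)"
    by (rule bij_betw_same_card)
  have "bij_betw ?h (\<Union>j\<in>{0..<int g}. ?Q j) (U_funs g s a \<times> U_funs g t b)"
  proof (rule bij_betw_imageI)
    show "inj_on ?h (\<Union>j\<in>{0..<int g}. ?Q j)"
    proof (rule inj_onI)
      fix x y assume x: "x \<in> (\<Union>j\<in>{0..<int g}. ?Q j)" and y: "y \<in> (\<Union>j\<in>{0..<int g}. ?Q j)" and xy: "?h x = ?h y"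
      obtain F G F' G' where xy': "x = (F, G)" "y = (F', G')" by (metis prod.exhaust)
      obtain j j' where j: "j \<in> {0..<int g}" "j' \<in> {0..<int g}" and FG: "(F, G) \<in> ?Q j" "(F', G') \<in> ?Q j'"
        using x y xy' by auto
      have eq: "gap g a F G = gap g a F' G'" "gap g b F G = gap g b F' G'" using xy xy' by auto
      have T: "F \<in> tops g" "G \<in> tops g" "F' \<in> tops g" "G' \<in> tops g" using FG by (auto simp: core_pairs_def)
      obtain k where k: "\<And>n. F' n = F n + int g * k" "\<And>n. G' n = G n + int g * k"
        by (rule gap_inject[OF assms(1,2) T eq]) (rule that)
      \<comment> \<open>The two charges differ by a multiple of \<open>g\<close> but both lie in
        \<open>{0..<g}\<close>.\<close>
      have "int g * (j' - j) = int g * (int g * k)"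
        using FG by (simp add: core_pairs_def k sum.distrib algebra_simps)
      then have "j' - j = int g * k" using g by simp
      moreover have "\<bar>j' - j\<bar> < int g" using j by auto
      ultimately have "k = 0" by (metis abs_mult abs_of_nat dvd_imp_le_int dvd_triv_left leD mult_eq_0_iff
          of_nat_0_eq_iff assms(1) less_numeral_extra(3))
      then show "x = y" using k xy' by (simp add: fun_eq_iff)
    qed
    show "?h ` (\<Union>j\<in>{0..<int g}. ?Q j) = U_funs g s a \<times> U_funs g t b"
    proof (intro equalityI subsetI)
      fix x assume "x \<in> ?h ` (\<Union>j\<in>{0..<int g}. ?Q j)"
      then show "x \<in> U_funs g s a \<times> U_funs g t b"
        using assms by (auto simp: core_pairs_def gap_in_U_funs_iff)
    next
      fix x assume "x \<in> U_funs g s a \<times> U_funs g t b"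
      then obtain u v where x: "x = (u, v)" and uv: "u \<in> U_funs g s a" "v \<in> U_funs g t b" by auto
      obtain F G j where FG: "F \<in> tops g" "G \<in> tops g" "j \<in> {0..<int g}"
        "(\<Sum>n\<in>{0..<int g}. F n) = (\<Sum>n\<in>{0..<int g}. n) + int g * j"
        "(\<Sum>n\<in>{0..<int g}. G n) = (\<Sum>n\<in>{0..<int g}. n) + int g * j"
        and gap: "gap g a F G = u" "gap g b F G = v"
        by (rule gap_surj[OF assms(1,2) uv]) (rule that)
      then have "(F, G) \<in> ?Q j"
        using uv gap_in_U_funs_iff[OF assms(1) FG(1,2) assms(3), of a] gap_in_U_funs_iff[OF assms(1) FG(1,2) assms(4), of b]
        by (simp add: core_pairs_def)
      then show "x \<in> ?h ` (\<Union>j\<in>{0..<int g}. ?Q j)"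
        using x gap FG(3) by (intro image_eqI[of _ _ "(F, G)"]) auto
    qed
  qed
  then have "card (\<Union>j\<in>{0..<int g}. ?Q j) = card (U_funs g s a \<times> U_funs g t b)"
    by (rule bij_betw_same_card)
  then show ?thesis using card1 by (simp add: card_cartesian_product mult.commute)
qed

section \<open>From pairs of first gaps back to bipartitions\<close>

lemma g_cores_tops:
  assumes "0 < g"
  obtains \<phi> where
    "bij_betw \<phi> (g_cores g) {F \<in> tops g. (\<Sum>n\<in>{0..<int g}. F n) = (\<Sum>n\<in>{0..<int g}. n)}"
    "\<And>lam. lam \<in> g_cores g \<Longrightarrow> below (\<phi> lam) = beta 0 lam"
proof -
  have "\<exists>F. F \<in> tops g \<and> below F = beta 0 lam" if "lam \<in> g_cores g" for lam
  proof -
    have lam: "is_partition lam" using that by (simp add: g_cores_def)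
    obtain L M where "{..<L} \<subseteq> beta 0 lam" "beta 0 lam \<subseteq> {..<M}"
      using maya_beta[OF lam, of 0] unfolding maya_def by blast
    then show ?thesis using obtain_tops[OF assms, of L "beta 0 lam" M] that g_cores_iff_beta[OF lam assms] by metis
  qed
  then obtain \<phi> where \<phi>: "\<And>lam. lam \<in> g_cores g \<Longrightarrow> \<phi> lam \<in> tops g"
    and below: "\<And>lam. lam \<in> g_cores g \<Longrightarrow> below (\<phi> lam) = beta 0 lam" by metis
  have part: "is_partition lam" if "lam \<in> g_cores g" for lam using that by (simp add: g_cores_def)
  have "bij_betw \<phi> (g_cores g) {F \<in> tops g. (\<Sum>n\<in>{0..<int g}. F n) = (\<Sum>n\<in>{0..<int g}. n)}"
  proof (rule bij_betw_imageI)
    show "inj_on \<phi> (g_cores g)"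
      using below part beta_inject by (intro inj_onI) metis
    show "\<phi> ` g_cores g = {F \<in> tops g. (\<Sum>n\<in>{0..<int g}. F n) = (\<Sum>n\<in>{0..<int g}. n)}"
    proof (intro equalityI subsetI)
      fix F assume "F \<in> \<phi> ` g_cores g"
      then obtain lam where lam: "lam \<in> g_cores g" "F = \<phi> lam" by blast
      then show "F \<in> {F \<in> tops g. (\<Sum>n\<in>{0..<int g}. F n) = (\<Sum>n\<in>{0..<int g}. n)}"
        \<comment> \<open>The sum condition says exactly that the charge is 0.\<close>
        using \<phi> maya_below_tops[OF assms \<phi>, of lam 0] below maya_beta[OF part, of lam 0] by simp
    next
      fix F assume "F \<in> {F \<in> tops g. (\<Sum>n\<in>{0..<int g}. F n) = (\<Sum>n\<in>{0..<int g}. n)}"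
      then have F: "F \<in> tops g" and "maya 0 (below F)" using maya_below_tops[OF assms, of F 0] by auto
      then obtain lam where lam: "is_partition lam" "beta 0 lam = below F"
        using maya_obtain_partition by blast
      then have "lam \<in> g_cores g" using g_cores_iff_beta[OF lam(1) assms] below_closed[OF F] by simp
      then show "F \<in> \<phi> ` g_cores g" using below_inject[OF \<phi> F] below lam by blast
    qed
  qed
  then show thesis using that below by blast
qed

lemma bicores_iff_sandwich:
  assumes "0 < s" "0 \<le> a" "a < int s" "g dvd s"
    and "is_partition lam" "is_partition mu" "F \<in> tops g" "G \<in> tops g"
    and lam: "beta 0 lam = below F" and mu: "beta 0 mu = below G"
  shows "(lam, mu) \<in> bicores s (0, a) \<longleftrightarrow> sandwich s a F G"
proof -
  \<comment> \<open>As \<open>g\<close> divides \<open>s\<close>, translation by \<open>s\<close>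
    preserves every class modulo \<open>g\<close>.\<close>
  have s: "shift (int s) F n = F n + int s" for n
  proof -
    have "F (n - int s) = F n"
    proof (rule tops_cong[OF assms(7)])
      show "(n - int s) mod int g = n mod int g" using \<open>g dvd s\<close> by (simp add: mod_eq_dvd_iff)
    qed
    then show ?thesis by (simp add: shift_def)
  qed
  have "(lam, mu) \<in> bicores s (0, a) \<longleftrightarrow>
      below F \<subseteq> below (shift a G) \<and> below (shift a G) \<subseteq> below (shift (int s) F)"
    using bicores_iff[of s "(lam, mu)" 0 a] beta_shift[of 0 a mu] assms
    by (simp add: is_bipartition_def below_shift)
  then show ?thesis
    using below_subset_iff[OF assms(7) shift_tops[OF assms(8)], of a]
      below_subset_iff[OF shift_tops[OF assms(8)] shift_tops[OF assms(7)], of a "int s"]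
    by (simp add: s sandwich_def) blast
qed

lemma card_bicores_eq_core_pairs:
  assumes "0 < s" "0 \<le> a" "a < int s" "0 < t" "0 \<le> b" "b < int t" "0 < g" "g dvd s" "g dvd t"
  shows "card (bicores s (0, a) \<inter> bicores t (0, b) \<inter> (g_cores g \<times> g_cores g)) = card (core_pairs g s a t b 0)"
proof -
  obtain \<phi> where bij: "bij_betw \<phi> (g_cores g) {F \<in> tops g. (\<Sum>n\<in>{0..<int g}. F n) = (\<Sum>n\<in>{0..<int g}. n)}"
    and below: "\<And>lam. lam \<in> g_cores g \<Longrightarrow> below (\<phi> lam) = beta 0 lam"
    by (rule g_cores_tops[OF \<open>0 < g\<close>]) (rule that)
  let ?S = "bicores s (0, a) \<inter> bicores t (0, b) \<inter> (g_cores g \<times> g_cores g)"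
  have tops: "\<phi> lam \<in> tops g" "(\<Sum>n\<in>{0..<int g}. \<phi> lam n) = (\<Sum>n\<in>{0..<int g}. n)" if "lam \<in> g_cores g" for lam
    using bij_betwE[OF bij] that by auto
  have iff: "(lam, mu) \<in> ?S \<longleftrightarrow> sandwich s a (\<phi> lam) (\<phi> mu) \<and> sandwich t b (\<phi> lam) (\<phi> mu)"
    if "lam \<in> g_cores g" "mu \<in> g_cores g" for lam mu
  proof -
    have "is_partition lam" "is_partition mu" using that by (auto simp: g_cores_def)
    then show ?thesis
      using bicores_iff_sandwich[of s a g lam mu "\<phi> lam" "\<phi> mu"]
        bicores_iff_sandwich[of t b g lam mu "\<phi> lam" "\<phi> mu"] assms that below tops by simp
  qed
  have "bij_betw (map_prod \<phi> \<phi>) ?S (core_pairs g s a t b 0)"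
  proof (rule bij_betw_imageI)
    show "inj_on (map_prod \<phi> \<phi>) ?S"
      by (rule inj_on_subset[OF map_prod_inj_on[OF bij_betw_imp_inj_on[OF bij] bij_betw_imp_inj_on[OF bij]]]) blast
    show "map_prod \<phi> \<phi> ` ?S = core_pairs g s a t b 0"
    proof (intro equalityI subsetI)
      fix x assume "x \<in> map_prod \<phi> \<phi> ` ?S"
      then obtain lam mu where "(lam, mu) \<in> ?S" "x = (\<phi> lam, \<phi> mu)" by auto
      moreover from this have "lam \<in> g_cores g" "mu \<in> g_cores g" by auto
      ultimately show "x \<in> core_pairs g s a t b 0" using iff tops by (simp add: core_pairs_def)
    next
      fix x assume "x \<in> core_pairs g s a t b 0"
      then obtain F G where x: "x = (F, G)" and FG: "(F, G) \<in> core_pairs g s a t b 0" by (cases x) auto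
      then have "F \<in> \<phi> ` g_cores g" "G \<in> \<phi> ` g_cores g"
        using bij_betw_imp_surj_on[OF bij] by (auto simp: core_pairs_def)
      then obtain lam mu where lm: "lam \<in> g_cores g" "mu \<in> g_cores g" "F = \<phi> lam" "G = \<phi> mu" by blast
      then have "(lam, mu) \<in> ?S" using FG iff by (simp add: core_pairs_def)
      then show "x \<in> map_prod \<phi> \<phi> ` ?S" using x lm by (intro image_eqI[of _ _ "(lam, mu)"]) auto
    qed
  qed
  then show ?thesis by (rule bij_betw_same_card)
qed

text \<open>From \<open>X \<subseteq> Y \<subseteq> X + s\<close> both bead sets are closed under
  subtracting \<open>s\<close>. For \<open>g = s\<close> the count of pairs of
  \<open>g\<close>-cores is thus a count of all common bicores.\<close>

lemma bicores_subset_cores: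
  assumes "0 < s" "0 \<le> a" "a < int s"
  shows "bicores s (0, a) \<subseteq> g_cores s \<times> g_cores s"
proof (rule subrelI)
  fix lam mu assume *: "(lam, mu) \<in> bicores s (0, a)"
  then have part: "is_bipartition (lam, mu)" by (simp add: bicores_def)
  then have XY: "beta 0 lam \<subseteq> beta a mu" "beta a mu \<subseteq> (+) (int s) ` beta 0 lam"
    using bicores_iff[OF assms(1) part, of 0 a] * assms by auto
  have mu: "beta a mu = (+) a ` beta 0 mu" using beta_shift[of 0 a] by simp
  have "x - int s \<in> beta 0 lam" if "x \<in> beta 0 lam" for x using XY that by auto
  moreover have "x - int s \<in> beta 0 mu" if "x \<in> beta 0 mu" for x
  proof -
    have "a + x \<in> beta a mu" using that mu by simp
    then have "a + x - int s \<in> beta a mu" using XY by force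
    then show ?thesis using mu by auto
  qed
  ultimately show "(lam, mu) \<in> g_cores s \<times> g_cores s"
    using part g_cores_iff_beta[OF _ assms(1)] by (simp add: is_bipartition_def)
qed

text \<open>With \<open>g = s\<close> the entries are 0 or 1, so the functions are indicators of
  subsets with \<open>a\<close> elements.\<close>

lemma card_U_funs_self:
  assumes "0 < s" "0 \<le> a"
  shows "card (U_funs s s a) = s choose nat a"
proof -
  let ?I = "{0..<int s}"
  let ?f = "\<lambda>A. restrict (\<lambda>n. of_bool (n \<in> A) :: int) ?I"
  have "bij_betw ?f {A. A \<subseteq> ?I \<and> card A = nat a} (U_funs s s a)"
  proof (rule bij_betw_byWitness[where f' = "\<lambda>u. {n \<in> ?I. u n = 1}"])
    show "\<forall>A\<in>{A. A \<subseteq> ?I \<and> card A = nat a}. {n \<in> ?I. ?f A n = 1} = A" by auto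
    have ind: "u n = of_bool (u n = 1)" if "u \<in> U_funs s s a" "n \<in> ?I" for u n
    proof -
      have "0 \<le> u n \<and> u n \<le> 1" using that assms(1) by (auto simp: U_funs_def)
      then show ?thesis by auto
    qed
    show "\<forall>u\<in>U_funs s s a. ?f {n \<in> ?I. u n = 1} = u"
    proof
      fix u assume u: "u \<in> U_funs s s a"
      show "?f {n \<in> ?I. u n = 1} = u"
      proof
        fix n show "?f {n \<in> ?I. u n = 1} n = u n"
          using ind[OF u, of n] u by (cases "n \<in> ?I") (auto simp: U_funs_def PiE_iff extensional_def)
      qed
    qed
    show "?f ` {A. A \<subseteq> ?I \<and> card A = nat a} \<subseteq> U_funs s s a"
    proof
      fix u assume "u \<in> ?f ` {A. A \<subseteq> ?I \<and> card A = nat a}"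
      then obtain A where A: "A \<subseteq> ?I" "card A = nat a" "u = ?f A" by blast
      have "(\<Sum>n\<in>?I. u n) = (\<Sum>n\<in>?I. of_bool (n \<in> A))" by (intro sum.cong) (auto simp: A)
      also have "\<dots> = int (card A)" using A(1) by (simp add: Int_absorb1)
      finally show "u \<in> U_funs s s a" using A assms by (auto simp: U_funs_def)
    qed
    show "(\<lambda>u. {n \<in> ?I. u n = 1}) ` U_funs s s a \<subseteq> {A. A \<subseteq> ?I \<and> card A = nat a}"
    proof
      fix A assume "A \<in> (\<lambda>u. {n \<in> ?I. u n = 1}) ` U_funs s s a"
      then obtain u where u: "u \<in> U_funs s s a" and A: "A = {n \<in> ?I. u n = 1}" by blast
      have "a = (\<Sum>n\<in>?I. u n)" using u by (simp add: U_funs_def)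
      also have "\<dots> = (\<Sum>n\<in>?I. of_bool (u n = 1))" by (intro sum.cong refl ind[OF u])
      also have "\<dots> = int (card A)" by (simp add: A Int_def)
      finally show "A \<in> {A. A \<subseteq> ?I \<and> card A = nat a}" by (auto simp: A)
    qed
  qed
  then have "card {A. A \<subseteq> ?I \<and> card A = nat a} = card (U_funs s s a)" by (rule bij_betw_same_card)
  then show ?thesis using n_subsets[of ?I "nat a"] by simp
qed

theorem theorem4p2:
  fixes s t g :: nat and a b :: int
  assumes "s > 0" and "t > 0"
    and "0 \<le> a" and "a < int s"
    and "0 \<le> b" and "b < int t"
    and "g = gcd s t"
    and "coprime (int g) (a - b)"
  shows "real (card (bicores s (0, a) \<inter> bicores t (0, b) \<inter> (g_cores g \<times> g_cores g)))
           = 1 / real g * real (card (U_funs g s a)) * real (card (U_funs g t b))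
       \<and> (s dvd t \<longrightarrow>
            real (card (bicores s (0, a) \<inter> bicores t (0, b)))
              = 1 / real s * real (s choose nat a) * real (card (U_funs s t b)))"
proof
  have g: "0 < g" "g dvd s" "g dvd t" using assms by auto
  have "g * card (bicores s (0, a) \<inter> bicores t (0, b) \<inter> (g_cores g \<times> g_cores g))
      = card (U_funs g s a) * card (U_funs g t b)"
    using card_core_pairs[OF g(1) assms(8) g(2,3)] card_bicores_eq_core_pairs[of s a t b g] assms g by simp
  from arg_cong[OF this, of real]
  show main: "real (card (bicores s (0, a) \<inter> bicores t (0, b) \<inter> (g_cores g \<times> g_cores g)))
      = 1 / real g * real (card (U_funs g s a)) * real (card (U_funs g t b))"
    using g(1) by (simp add: field_simps)
  show "s dvd t \<longrightarrow> real (card (bicores s (0, a) \<inter> bicores t (0, b)))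
      = 1 / real s * real (s choose nat a) * real (card (U_funs s t b))"
  proof
    assume "s dvd t"
    then have "g = s" using assms(7) by (simp add: gcd_nat.absorb1)
    moreover have "bicores s (0, a) \<inter> bicores t (0, b) \<inter> (g_cores s \<times> g_cores s) = bicores s (0, a) \<inter> bicores t (0, b)"
      using bicores_subset_cores[OF assms(1,3,4)] by blast
    ultimately show "real (card (bicores s (0, a) \<inter> bicores t (0, b)))
      = 1 / real s * real (s choose nat a) * real (card (U_funs s t b))"
      using main card_U_funs_self[OF assms(1,3)] by simp
  qed
qed

end
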